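(* Let $I\subseteq\mathbb{R}$ be an interval, $(X,\mathbf{d})$ a metric space, and let $\gamma:I\to X$ be locally of bounded variation. Then the speed measure $\nu$ of $\gamma$ is the unique measure on $(I,\mathcal{B}(I))$ such that for all intervals $J\subseteq I$ that are open in $I$ one has $$\nu(J)=\operatorname{Var}(\gamma;J).\qquad ( * )$$ Moreover, for every $t\in I$, $$\nu(\{t\})=\operatorname{V}_\gamma(t+)-\operatorname{V}_\gamma(t-)=\mathbf{d}(\gamma(t-),\gamma(t))+\mathbf{d}(\gamma(t),\gamma(t+)).$$ Furthermore, $\nu$ is continuous (i.e. $\nu(\{t\})=0$ for all $t\in I$) if and only if $\gamma$ is a curve, i.e. continuous. In this case, $( * )$ holds for all intervals $J\subseteq I$.
   Context: An interval is a connected subset of $\mathbb{R}$. For $\gamma:I\to X$ and a subinterval $J\subseteq I$, $\operatorname{Var}(\gamma;J)\in[0,\infty]$ is the supremum of $\sum_{k=1}^n\mathbf{d}(\gamma(t_k),\gamma(t_{k+1}))$ over all $n\in\mathbb{N}$ and all $t_1\le t_2\le\dots\le t_{n+1}$ in $J$ (the supremum of the empty set being $0$). $\gamma$ is locally of bounded variation if $\operatorname{Var}(\gamma;[a,b])<\infty$ for all $a\le b$ in $I$. Convention: $\operatorname{Var}(\gamma;[b,a]):=-\operatorname{Var}(\gamma;[a,b])$ for $a\le b$ in $I$. Fix $c\in I$ and set $\operatorname{V}_\gamma(t):=\operatorname{Var}(\gamma;[c,t])$ for $t\in I$; this is a nondecreasing real function with $\operatorname{Var}(\gamma;[a,b])=\operatorname{V}_\gamma(b)-\operatorname{V}_\gamma(a)$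 (changing $c$ only adds a constant). $\operatorname{V}_\gamma(t-)$, $\operatorname{V}_\gamma(t+)$ denote its left and right limits, with $\operatorname{V}_\gamma(a-):=\operatorname{V}_\gamma(a)$ if $a=\inf I\in I$ and $\operatorname{V}_\gamma(b+):=\operatorname{V}_\gamma(b)$ if $b=\sup I\in I$. Speed measure: let $\operatorname{v}(t):=\operatorname{V}_\gamma(t+)$, $t\in I$, and let $\mu_{\operatorname{v}}$ be the Lebesgue–Stieltjes measure on the Borel sets of $I$, characterized by $\mu_{\operatorname{v}}((s,t])=\operatorname{v}(t)-\operatorname{v}(s)$ for $s\le t$ in $I$ (and $\mu_{\operatorname{v}}(\{a\})=0$ if $a=\inf I\in I$). If $a=\inf I\in I$, the speed measure is $\nu:=\mu_{\operatorname{v}}+(\operatorname{V}_\gamma(a+)-\operatorname{V}_\gamma(a))\delta_a$; otherwise $\nu:=\mu_{\operatorname{v}}$. One-sided jumps: $\mathbf{d}(\gamma(t-),\gamma(t)):=\lim_{s\nearrow t}\mathbf{d}(\gamma(s),\gamma(t))$ and $\mathbf{d}(\gamma(t),\gamma(t+)):=\lim_{s\searrow t}\mathbf{d}(\gamma(t),\gamma(s))$ (limits over $s\in I$; they exist when $\gamma$ is locally of bounded variation), where the first is $0$ if $t=\inf I\in I$ and the second is $0$ if $t=\sup I\in I$. *)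

theory Defs
  imports "HOL-Analysis.Analysis"
begin

definition variation :: "(real \<Rightarrow> 'a::metric_space) \<Rightarrow> real set \<Rightarrow> ennreal" where
  "variation \<gamma> J =
     Sup {\<Sum>k=1..n. ennreal (dist (\<gamma> (t k)) (\<gamma> (t (k + 1)))) | (n::nat) (t :: nat \<Rightarrow> real).
            (\<forall>k\<in>{1..n+1}. t k \<in> J) \<and> (\<forall>k\<in>{1..n}. t k \<le> t (k + 1))}"

definition locally_bounded_variation :: "real set \<Rightarrow> (real \<Rightarrow> 'a::metric_space) \<Rightarrow> bool" where
  "locally_bounded_variation I \<gamma> \<longleftrightarrow>
     (\<forall>a\<in>I. \<forall>b\<in>I. a \<le> b \<longrightarrow> variation \<gamma> {a..b} < \<infinity>)"

definition variation_fun :: "(real \<Rightarrow> 'a::metric_space) \<Rightarrow> real \<Rightarrow> real \<Rightarrow> real" where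
  "variation_fun \<gamma> c t =
     (if c \<le> t then enn2real (variation \<gamma> {c..t}) else - enn2real (variation \<gamma> {t..c}))"

text \<open>\<open>a = inf I \<in> I\<close> and \<open>b = sup I \<in> I\<close>, stated pointwise because \<^const>\<open>Inf\<close> and
  \<^const>\<open>Sup\<close> have unspecified values on unbounded sets of reals.\<close>

definition is_left_end :: "real set \<Rightarrow> real \<Rightarrow> bool" where
  "is_left_end I a \<longleftrightarrow> a \<in> I \<and> (\<forall>s\<in>I. a \<le> s)"

definition is_right_end :: "real set \<Rightarrow> real \<Rightarrow> bool" where
  "is_right_end I b \<longleftrightarrow> b \<in> I \<and> (\<forall>s\<in>I. s \<le> b)"

definition llim :: "real set \<Rightarrow> (real \<Rightarrow> real) \<Rightarrow> real \<Rightarrow> real" where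
  "llim I f t = (if is_left_end I t then f t else Lim (at t within I \<inter> {..<t}) f)"

definition rlim :: "real set \<Rightarrow> (real \<Rightarrow> real) \<Rightarrow> real \<Rightarrow> real" where
  "rlim I f t = (if is_right_end I t then f t else Lim (at t within I \<inter> {t<..}) f)"

text \<open>The one-sided jumps \<open>d(\<gamma>(t-), \<gamma>(t))\<close> and \<open>d(\<gamma>(t), \<gamma>(t+))\<close>. At an endpoint of \<open>I\<close> belonging
  to \<open>I\<close> the outward one is \<open>dist (\<gamma> t) (\<gamma> t) = 0\<close>.\<close>

definition left_jump :: "real set \<Rightarrow> (real \<Rightarrow> 'a::metric_space) \<Rightarrow> real \<Rightarrow> real" where
  "left_jump I \<gamma> t = llim I (\<lambda>s. dist (\<gamma> s) (\<gamma> t)) t"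

definition right_jump :: "real set \<Rightarrow> (real \<Rightarrow> 'a::metric_space) \<Rightarrow> real \<Rightarrow> real" where
  "right_jump I \<gamma> t = rlim I (\<lambda>s. dist (\<gamma> t) (\<gamma> s)) t"

text \<open>The Lebesgue--Stieltjes measure on the interval \<open>I\<close> of a nondecreasing right-continuous
  \<open>v\<close>. It is not a restriction of an \<^const>\<open>interval_measure\<close>: \<open>v\<close> may be unbounded near an
  endpoint of \<open>I\<close> not belonging to \<open>I\<close>, so it need not extend to the whole real line.\<close>

definition stieltjes_measure :: "real set \<Rightarrow> (real \<Rightarrow> real) \<Rightarrow> real measure" where
  "stieltjes_measure I v = (THE \<mu>.
     sets \<mu> = sets (restrict_space borel I) \<and>
     (\<forall>s\<in>I. \<forall>t\<in>I. s \<le> t \<longrightarrow> emeasure \<mu> {s<..t} = ennreal (v t - v s)) \<and>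
     (\<forall>a. is_left_end I a \<longrightarrow> emeasure \<mu> {a} = 0))"

definition speed_measure :: "real set \<Rightarrow> (real \<Rightarrow> 'a::metric_space) \<Rightarrow> real \<Rightarrow> real measure" where
  "speed_measure I \<gamma> c =
     (let V = variation_fun \<gamma> c; \<mu> = stieltjes_measure I (rlim I V); a = Inf I in
      measure_of I (sets (restrict_space borel I))
        (\<lambda>A. emeasure \<mu> A +
              (if is_left_end I a then ennreal (rlim I V a - V a) * indicator A a else 0)))"

end

theory Submission
  imports Defs
begin

text \<open>Write \<open>V\<close> for the variation function. The speed measure gives a compact interval \<open>{s..t}\<close> the
  mass \<open>V(t+) - V(s-)\<close>, whereas its variation is \<open>V t - V s\<close>. Both the measure and the variation of
  an interval \<open>J\<close> are suprema over the compact subintervals of \<open>J\<close>, and these suprema agree as soon as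
  every point of \<open>J\<close> can be moved outwards within \<open>J\<close> past the one-sided limits: this is so if \<open>J\<close> is
  open in \<open>I\<close>, and trivially if \<open>V\<close> is continuous. That the jumps of \<open>V\<close> are those of \<open>\<gamma>\<close> follows from
  the minimality of \<open>V\<close> among the functions whose increments dominate the distances.\<close>

subsection \<open>Variation\<close>

text \<open>Compact intervals carry the argument because they serve both sides: every sum in the
  variation lives on the compact interval spanned by its points, and they generate the Borel sets of
  \<open>I\<close> including a left endpoint, which no \<open>{s<..t}\<close> with \<open>s\<close>
  in \<open>I\<close> contains. At such an endpoint V(a-) = V(a) by convention, and the extra point
  mass V(a+) - V(a) is exactly what extends the mass formula to \<open>s = a\<close>. Two obstacles
  shape the rest. The space is not assumed complete, so \<gamma> may have no one-sided limits; only
  limits of distances are used, and they are read off from those of V. And V may be unbounded near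
  an end missing from \<open>I\<close>, so \<nu> can be infinite on \<open>I\<close>; uniqueness
  therefore subtracts two open tails from an open interval of finite variation around
  \<open>{s..t}\<close> instead of taking complements in \<open>I\<close>.\<close>

lemma ennreal_Sup_add_Sup_le:
  fixes A B :: "ennreal set"
  assumes "A \<noteq> {}" "B \<noteq> {}" "\<And>x y. x \<in> A \<Longrightarrow> y \<in> B \<Longrightarrow> x + y \<le> C"
  shows "Sup A + Sup B \<le> C"
proof -
  have "x + Sup B \<le> C" if "x \<in> A" for x
    using ennreal_SUP_add_right[of B x "\<lambda>y. y"] assms(2,3) that by (auto intro: SUP_least)
  then have "(SUP x\<in>A. x + Sup B) \<le> C" by (rule SUP_least)
  then show ?thesis
    using ennreal_SUP_add_left[of A "\<lambda>x. x" "Sup B"] assms(1) by simp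
qed

lemma variation_mono: "J \<subseteq> K \<Longrightarrow> variation \<gamma> J \<le> variation \<gamma> K"
  unfolding variation_def by (rule Sup_subset_mono) blast

lemma sum_le_variation:
  fixes n :: nat
  assumes "\<And>k. k \<in> {1..n+1} \<Longrightarrow> t k \<in> J" "\<And>k. k \<in> {1..n} \<Longrightarrow> t k \<le> t (k + 1)"
  shows "(\<Sum>k=1..n. ennreal (dist (\<gamma> (t k)) (\<gamma> (t (k + 1))))) \<le> variation \<gamma> J"
  unfolding variation_def
  by (rule Sup_upper, rule CollectI, intro exI[of _ n] exI[of _ t]) (use assms in auto)

lemma variation_leI:
  assumes "\<And>(n::nat) t. (\<And>k. k \<in> {1..n+1} \<Longrightarrow> t k \<in> J) \<Longrightarrow> (\<And>k. k \<in> {1..n} \<Longrightarrow> t k \<le> t (k + 1)) \<Longrightarrow>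
    (\<Sum>k=1..n. ennreal (dist (\<gamma> (t k)) (\<gamma> (t (k + 1))))) \<le> C"
  shows "variation \<gamma> J \<le> C"
  unfolding variation_def
proof (rule Sup_least, clarify)
  fix n :: nat and t :: "nat \<Rightarrow> real"
  assume "\<forall>k\<in>{1..n+1}. t k \<in> J" "\<forall>k\<in>{1..n}. t k \<le> t (k + 1)"
  then show "(\<Sum>k=1..n. ennreal (dist (\<gamma> (t k)) (\<gamma> (t (k + 1))))) \<le> C"
    by (intro assms) blast+
qed

lemma variation_empty [simp]: "variation \<gamma> {} = 0"
proof -
  have "variation \<gamma> {} \<le> 0"
  proof (rule variation_leI)
    fix n :: nat and t :: "nat \<Rightarrow> real"
    assume "\<And>k. k \<in> {1..n+1} \<Longrightarrow> t k \<in> {}"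
    \<comment> \<open>Even for \<open>n = 0\<close> a family has the point \<open>t 1\<close>, so
      the empty set admits no family at all.\<close>
    from this[of 1] show "(\<Sum>k=1..n. ennreal (dist (\<gamma> (t k)) (\<gamma> (t (k + 1))))) \<le> 0"
      by simp
  qed
  then show ?thesis by simp
qed

lemma dist_le_variation:
  assumes "a \<in> J" "b \<in> J" "a \<le> b"
  shows "ennreal (dist (\<gamma> a) (\<gamma> b)) \<le> variation \<gamma> J"
proof -
  let ?t = "\<lambda>k::nat. if k = 1 then a else b"
  have "(\<Sum>k=1..1. ennreal (dist (\<gamma> (?t k)) (\<gamma> (?t (k + 1))))) \<le> variation \<gamma> J"
    by (rule sum_le_variation) (use assms in auto)
  then show ?thesis by simp
qed

lemma partition_mono:
  fixes t :: "nat \<Rightarrow> real"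
  assumes "\<And>k. k \<in> {1..n} \<Longrightarrow> t k \<le> t (k + 1)" "1 \<le> i" "i \<le> j" "j \<le> n + 1"
  shows "t i \<le> t j"
  using assms(3,4)
proof (induction j rule: dec_induct)
  case (step k)
  with assms(1)[of k] assms(2) show ?case by auto
qed simp

text \<open>A finite family only sees the interval between its first and last point. Together with
  \<open>emeasure_interval_eq_SUP\<close> this reduces the comparison of measure and variation to
  compact intervals.\<close>

lemma variation_eq_SUP:
  assumes "is_interval J"
  shows "variation \<gamma> J = (SUP (a, b)\<in>{(a, b). a \<in> J \<and> b \<in> J \<and> a \<le> b}. variation \<gamma> {a..b})"
    (is "_ = ?S")
proof (rule antisym)
  show "variation \<gamma> J \<le> ?S"
  proof (rule variation_leI)
    fix n :: nat and t :: "nat \<Rightarrow> real"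
    assume t: "\<And>k. k \<in> {1..n+1} \<Longrightarrow> t k \<in> J" and le: "\<And>k. k \<in> {1..n} \<Longrightarrow> t k \<le> t (k + 1)"
    have "(\<Sum>k=1..n. ennreal (dist (\<gamma> (t k)) (\<gamma> (t (k + 1))))) \<le> variation \<gamma> {t 1..t (n + 1)}"
      by (rule sum_le_variation) (use partition_mono[of n t] le in auto)
    also have "\<dots> \<le> ?S"
      using t partition_mono[of n t 1 "n + 1"] le
      by (intro SUP_upper2[of "(t 1, t (n + 1))"]) auto
    finally show "(\<Sum>k=1..n. ennreal (dist (\<gamma> (t k)) (\<gamma> (t (k + 1))))) \<le> ?S" .
  qed
  show "?S \<le> variation \<gamma> J"
    using assms by (auto intro!: SUP_least variation_mono simp: is_interval_1)
qed

lemma variation_superadditive: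
  assumes "a \<le> b" "b \<le> c"
  shows "variation \<gamma> {a..b} + variation \<gamma> {b..c} \<le> variation \<gamma> {a..c}"
  unfolding variation_def[of \<gamma> "{a..b}"] variation_def[of \<gamma> "{b..c}"]
\<comment> \<open>The suprema must run over nonempty sets, since \<open>Sup {} = 0\<close> would
  make the hypothesis vacuous; one-point families with \<open>n = 0\<close> provide members. Case 3
  concatenates two families.\<close>
proof (rule ennreal_Sup_add_Sup_le, goal_cases)
  case 1
  show ?case using assms by (auto intro!: exI[of _ 0] exI[of _ "\<lambda>_. a"])
next
  case 2
  show ?case using assms by (auto intro!: exI[of _ 0] exI[of _ "\<lambda>_. b"])
next
  case (3 x y)
  let ?s = "\<lambda>(n::nat) t. \<Sum>k=1..n. ennreal (dist (\<gamma> (t k)) (\<gamma> (t (k + 1))))"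
  from 3 obtain n t m u where
    t: "x = ?s n t" "\<forall>k\<in>{1..n+1}. t k \<in> {a..b}" "\<forall>k\<in>{1..n}. t k \<le> t (k + 1)" and
    u: "y = ?s m u" "\<forall>k\<in>{1..m+1}. u k \<in> {b..c}" "\<forall>k\<in>{1..m}. u k \<le> u (k + 1)"
    by blast
  \<comment> \<open>The \<open>n + 1\<close> points of \<open>t\<close> are followed by the
    \<open>m + 1\<close> points of \<open>u\<close>, which gives \<open>n + 1 + m\<close> gaps. Gap
    \<open>n + 1\<close> bridges from \<open>t (n + 1) \<le> b\<close> to
    \<open>u 1 \<ge> b\<close>; it belongs to neither sum and is discarded at the end.\<close>
  define w where "w k = (if k \<le> n + 1 then t k else u (k - (n + 1)))" for k
  have w1: "w k \<in> {a..c}" if "k \<in> {1..(n + 1 + m) + 1}" for k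
  proof (cases "k \<le> n + 1")
    case True
    then show ?thesis using that t(2) assms by (force simp: w_def)
  next
    case False
    then have "k - (n + 1) \<in> {1..m+1}" using that by auto
    then show ?thesis using False u(2) assms by (force simp: w_def)
  qed
  have w2: "w k \<le> w (k + 1)" if "k \<in> {1..n + 1 + m}" for k
  proof -
    consider "k \<le> n" | "k = n + 1" | "k > n + 1" by linarith
    then show ?thesis
    proof cases
      case 1
      then show ?thesis using that t(3) by (auto simp: w_def)
    next
      case 2
      then have "w k = t (n + 1)" "w (k + 1) = u 1" by (auto simp: w_def)
      moreover have "t (n + 1) \<le> b" "b \<le> u 1" using t(2) u(2) by auto
      ultimately show ?thesis by linarith
    next
      case 3
      then have "k - (n + 1) \<in> {1..m}" using that by auto
      with u(3) have "u (k - (n + 1)) \<le> u (k - (n + 1) + 1)" by blast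
      moreover have "k - (n + 1) + 1 = k + 1 - (n + 1)" using 3 by simp
      ultimately show ?thesis using 3 by (simp add: w_def)
    qed
  qed
  let ?d = "\<lambda>k. ennreal (dist (\<gamma> (w k)) (\<gamma> (w (k + 1))))"
  have "x = sum ?d {1..n}"
    unfolding t(1) by (rule sum.cong) (auto simp: w_def)
  moreover have "y = sum ?d {n + 2..n + 1 + m}"
    unfolding u(1)
    by (rule sum.reindex_bij_witness[of _ "\<lambda>k. k - (n + 1)" "\<lambda>k. k + (n + 1)"])
      (auto simp: w_def)
  ultimately have "x + y = sum ?d ({1..n} \<union> {n + 2..n + 1 + m})"
    by (subst sum.union_disjoint) auto
  also have "\<dots> \<le> sum ?d {1..n + 1 + m}"
    by (rule sum_mono2) auto
  also have "\<dots> \<le> variation \<gamma> {a..c}"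
    by (rule sum_le_variation) (use w1 w2 in auto)
  finally show ?case .
qed

text \<open>The variation is the least additive interval function dominating the metric. This is how
  upper bounds are obtained below, without inserting points into partitions.\<close>

lemma variation_le_of_dominated:
  fixes W :: "real \<Rightarrow> real"
  assumes dom: "\<And>x y. a \<le> x \<Longrightarrow> x \<le> y \<Longrightarrow> y \<le> b \<Longrightarrow> dist (\<gamma> x) (\<gamma> y) \<le> W y - W x"
  shows "variation \<gamma> {a..b} \<le> ennreal (W b - W a)"
proof (rule variation_leI)
  fix n :: nat and t :: "nat \<Rightarrow> real"
  assume t: "\<And>k. k \<in> {1..n+1} \<Longrightarrow> t k \<in> {a..b}" and le: "\<And>k. k \<in> {1..n} \<Longrightarrow> t k \<le> t (k + 1)"
  have W: "W x \<le> W y" if "a \<le> x" "x \<le> y" "y \<le> b" for x y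
    using dom[OF that] zero_le_dist[of "\<gamma> x" "\<gamma> y"] by linarith
  have "(\<Sum>k=1..n. dist (\<gamma> (t k)) (\<gamma> (t (k + 1)))) \<le> (\<Sum>k=1..n. W (t (k + 1)) - W (t k))"
  proof (rule sum_mono)
    fix k assume k: "k \<in> {1..n}"
    then show "dist (\<gamma> (t k)) (\<gamma> (t (k + 1))) \<le> W (t (k + 1)) - W (t k)"
      using t[of k] t[of "k + 1"] le[of k] by (intro dom) auto
  qed
  also have "\<dots> = W (t (n + 1)) - W (t 1)"
    using sum_Suc_diff[of 1 n "\<lambda>k. W (t k)"] by simp
  also have "\<dots> \<le> W b - W a"
    using W[of a "t 1"] W[of "t (n + 1)" b] t[of 1] t[of "n + 1"] by auto
  finally show "(\<Sum>k=1..n. ennreal (dist (\<gamma> (t k)) (\<gamma> (t (k + 1))))) \<le> ennreal (W b - W a)"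
    by (simp add: sum_ennreal ennreal_leI)
qed

lemma variation_real_superadditive:
  assumes "a \<le> b" "b \<le> c" "variation \<gamma> {a..c} < \<infinity>"
  shows "enn2real (variation \<gamma> {a..b}) + enn2real (variation \<gamma> {b..c}) \<le> enn2real (variation \<gamma> {a..c})"
proof -
  have fin: "variation \<gamma> {a..b} < \<infinity>" "variation \<gamma> {b..c} < \<infinity>"
    using variation_mono[of "{a..b}" "{a..c}" \<gamma>] variation_mono[of "{b..c}" "{a..c}" \<gamma>] assms
    by (auto intro: le_less_trans)
  then show ?thesis
    using variation_superadditive[OF assms(1,2), of \<gamma>] assms(3)
    by (simp flip: enn2real_plus add: enn2real_mono)
qed

text \<open>The missing inequality comes from a dominating function: the variations measured from
  \<open>a\<close> up to \<open>b\<close> and from \<open>b\<close> onwards are glued at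
  \<open>b\<close>, and pairs on different sides of \<open>b\<close> are handled by the triangle
  inequality through \<gamma>(b).\<close>

lemma variation_real_additive:
  assumes "a \<le> b" "b \<le> c" "variation \<gamma> {a..c} < \<infinity>"
  shows "enn2real (variation \<gamma> {a..c}) = enn2real (variation \<gamma> {a..b}) + enn2real (variation \<gamma> {b..c})"
proof (rule antisym)
  define r where "r x y = enn2real (variation \<gamma> {x..y})" for x y
  have fin: "variation \<gamma> {x..y} < \<infinity>" if "a \<le> x" "y \<le> c" for x y
    using variation_mono[of "{x..y}" "{a..c}" \<gamma>] assms(3) that by (auto intro: le_less_trans)
  \<comment> \<open>The base point \<open>z\<close> stays free because the glued function uses base
    \<open>a\<close> left of \<open>b\<close> and base \<open>b\<close> right of it.\<close>
  have r: "dist (\<gamma> x) (\<gamma> y) \<le> r z y - r z x" if "a \<le> z" "z \<le> x" "x \<le> y" "y \<le> c" for x y z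
  proof -
    have "dist (\<gamma> x) (\<gamma> y) \<le> r x y"
    proof (rule ennreal_le_iff[THEN iffD1])
      show "ennreal (dist (\<gamma> x) (\<gamma> y)) \<le> ennreal (r x y)"
        using dist_le_variation[of x "{x..y}" y \<gamma>] fin[of x y] that
        by (simp add: r_def less_top)
    qed (simp add: r_def)
    moreover have "r z x + r x y \<le> r z y"
      unfolding r_def using that fin[of z y] by (intro variation_real_superadditive) auto
    ultimately show ?thesis by linarith
  qed
  have nonneg: "0 \<le> r x y" for x y by (simp add: r_def)
  define W where "W x = (if x \<le> b then r a x else r a b + r b x)" for x
  have "variation \<gamma> {a..c} \<le> ennreal (W c - W a)"
  proof (rule variation_le_of_dominated)
    fix x y assume xy: "a \<le> x" "x \<le> y" "y \<le> c"
    consider "y \<le> b" | "b < x" | "x \<le> b" "b < y" by linarith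
    then show "dist (\<gamma> x) (\<gamma> y) \<le> W y - W x"
    proof cases
      case 3
      have "dist (\<gamma> x) (\<gamma> y) \<le> dist (\<gamma> x) (\<gamma> b) + dist (\<gamma> b) (\<gamma> y)" by (rule dist_triangle)
      then show ?thesis
        using 3 xy r[of a x b] r[of b b y] nonneg[of b b] assms by (simp add: W_def)
    qed (use xy r[of a x y] r[of b x y] assms in \<open>auto simp: W_def\<close>)
  qed
  \<comment> \<open>An inequality is enough: \<open>r a a\<close> only has to be nonnegative, and
    for \<open>c = b\<close> the term \<open>r b c\<close> is absent from
    \<open>W c\<close>.\<close>
  moreover have "W c - W a \<le> r a b + r b c"
    using assms nonneg[of a a] nonneg[of b c] by (auto simp: W_def)
  moreover have "0 \<le> r a b + r b c" using nonneg[of a b] nonneg[of b c] by linarith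
  ultimately have "variation \<gamma> {a..c} \<le> ennreal (r a b + r b c)"
    by (meson ennreal_leI order_trans)
  then show "enn2real (variation \<gamma> {a..c}) \<le> enn2real (variation \<gamma> {a..b}) + enn2real (variation \<gamma> {b..c})"
    using \<open>0 \<le> r a b + r b c\<close> by (simp add: enn2real_leI r_def)
qed (use variation_real_superadditive assms in blast)


subsection \<open>One-sided limits of monotone functions on intervals\<close>

lemma Icc_subset_interval: "is_interval I \<Longrightarrow> s \<in> I \<Longrightarrow> t \<in> I \<Longrightarrow> {s..t} \<subseteq> (I :: real set)"
  unfolding is_interval_1 by (meson atLeastAtMost_iff subsetI)

lemma at_within_left_nontrivial:
  assumes "is_interval I" "t \<in> I" "\<not> is_left_end I t"
  shows "at t within I \<inter> {..<t} \<noteq> bot"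
proof -
  obtain s where s: "s \<in> I" "s < t"
    using assms by (auto simp: is_left_end_def not_le)
  have "{s<..<t} \<subseteq> I \<inter> {..<t}"
    using Icc_subset_interval[OF assms(1) s(1) assms(2)] by auto
  then have "t islimpt I \<inter> {..<t}"
    using islimpt_subset islimpt_greaterThanLessThan2[OF s(2)] by blast
  then show ?thesis by (simp add: trivial_limit_within)
qed

lemma at_within_right_nontrivial:
  assumes "is_interval I" "t \<in> I" "\<not> is_right_end I t"
  shows "at t within I \<inter> {t<..} \<noteq> bot"
proof -
  obtain s where s: "s \<in> I" "t < s"
    using assms by (auto simp: is_right_end_def not_le)
  have "{t<..<s} \<subseteq> I \<inter> {t<..}"
    using Icc_subset_interval[OF assms(1) assms(2) s(1)] by auto
  then have "t islimpt I \<inter> {t<..}"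
    using islimpt_subset islimpt_greaterThanLessThan1[OF s(2)] by blast
  then show ?thesis by (simp add: trivial_limit_within)
qed

lemma left_end_at_within: "is_left_end I t \<Longrightarrow> at t within I \<inter> {..<t} = bot"
  by (subgoal_tac "I \<inter> {..<t} = {}") (auto simp: is_left_end_def)

lemma right_end_at_within: "is_right_end I t \<Longrightarrow> at t within I \<inter> {t<..} = bot"
  by (subgoal_tac "I \<inter> {t<..} = {}") (auto simp: is_right_end_def)

text \<open>The last hypothesis covers the degenerate case: at a left endpoint the filter is
  \<open>bot\<close>, convergence says nothing, and the value is fixed by the convention in
  \<open>llim\<close>.\<close>

lemma llim_eqI:
  assumes "is_interval I" "t \<in> I" "(f \<longlongrightarrow> l) (at t within I \<inter> {..<t})"
    "is_left_end I t \<Longrightarrow> l = f t"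
  shows "llim I f t = l"
  using assms at_within_left_nontrivial[of I t] by (auto simp: llim_def intro: tendsto_Lim)

lemma rlim_eqI:
  assumes "is_interval I" "t \<in> I" "(f \<longlongrightarrow> l) (at t within I \<inter> {t<..})"
    "is_right_end I t \<Longrightarrow> l = f t"
  shows "rlim I f t = l"
  using assms at_within_right_nontrivial[of I t] by (auto simp: rlim_def intro: tendsto_Lim)

context
  fixes I :: "real set" and f :: "real \<Rightarrow> real"
  assumes ivl: "is_interval I" and mono: "mono_on I f"
begin

text \<open>Monotonicity makes the supremum over the points left of \<open>t\<close> the limit. At a
  left endpoint the filter is \<open>bot\<close>, so later arguments need no case distinction
  there.\<close>

lemma tendsto_llim:
  assumes "t \<in> I"
  shows "(f \<longlongrightarrow> llim I f t) (at t within I \<inter> {..<t})"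
proof (cases "is_left_end I t")
  case False
  have *: "(f \<longlongrightarrow> Sup (f ` ({..<t} \<inter> I))) (at t within {..<t} \<inter> I)"
    by (rule Lim_left_bound[of I t f "f t"])
      (use assms in \<open>auto intro!: mono_onD[OF mono]\<close>)
  then show ?thesis
    using llim_eqI[OF ivl assms, of f] False by (metis Int_commute)
qed (simp add: left_end_at_within)

lemma tendsto_rlim:
  assumes "t \<in> I"
  shows "(f \<longlongrightarrow> rlim I f t) (at t within I \<inter> {t<..})"
proof (cases "is_right_end I t")
  case False
  have *: "(f \<longlongrightarrow> Inf (f ` ({t<..} \<inter> I))) (at t within {t<..} \<inter> I)"
    by (rule Lim_right_bound[of I t f "f t"])
      (use assms in \<open>auto intro!: mono_onD[OF mono]\<close>)
  then show ?thesis
    using rlim_eqI[OF ivl assms, of f] False by (metis Int_commute)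
qed (simp add: right_end_at_within)

lemma le_llim:
  assumes "x \<in> I" "t \<in> I" "x < t"
  shows "f x \<le> llim I f t"
proof (rule tendsto_lowerbound[OF tendsto_llim[OF assms(2)]])
  have "f x \<le> f y" if "y \<in> {x<..}" "y \<in> I" for y
    using mono_onD[OF mono, of x y] that assms by simp
  then show "eventually (\<lambda>y. f x \<le> f y) (at t within I \<inter> {..<t})"
    unfolding eventually_at_topological using assms(3) by (intro exI[of _ "{x<..}"]) simp
  show "at t within I \<inter> {..<t} \<noteq> bot"
    using assms ivl by (intro at_within_left_nontrivial) (auto simp: is_left_end_def not_le)
qed

lemma rlim_le:
  assumes "x \<in> I" "t \<in> I" "t < x"
  shows "rlim I f t \<le> f x"
proof (rule tendsto_upperbound[OF tendsto_rlim[OF assms(2)]])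
  have "f y \<le> f x" if "y \<in> {..<x}" "y \<in> I" for y
    using mono_onD[OF mono, of y x] that assms by simp
  then show "eventually (\<lambda>y. f y \<le> f x) (at t within I \<inter> {t<..})"
    unfolding eventually_at_topological using assms(3) by (intro exI[of _ "{..<x}"]) simp
  show "at t within I \<inter> {t<..} \<noteq> bot"
    using assms ivl by (intro at_within_right_nontrivial) (auto simp: is_right_end_def not_le)
qed

lemma llim_leI:
  assumes "t \<in> I" "\<not> is_left_end I t" "\<And>x. x \<in> I \<Longrightarrow> x < t \<Longrightarrow> f x \<le> K"
  shows "llim I f t \<le> K"
  by (rule tendsto_upperbound[OF tendsto_llim[OF assms(1)]])
    (simp_all add: eventually_at_filter assms at_within_left_nontrivial[OF ivl assms(1,2)])

lemma le_rlimI: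
  assumes "t \<in> I" "\<not> is_right_end I t" "\<And>x. x \<in> I \<Longrightarrow> t < x \<Longrightarrow> K \<le> f x"
  shows "K \<le> rlim I f t"
  by (rule tendsto_lowerbound[OF tendsto_rlim[OF assms(1)]])
    (simp_all add: eventually_at_filter assms at_within_right_nontrivial[OF ivl assms(1,2)])

lemma llim_le:
  assumes "t \<in> I"
  shows "llim I f t \<le> f t"
proof (cases "is_left_end I t")
  case False
  then show ?thesis using llim_leI[OF assms] mono_onD[OF mono] assms by simp
qed (simp add: llim_def)

lemma le_rlim:
  assumes "t \<in> I"
  shows "f t \<le> rlim I f t"
proof (cases "is_right_end I t")
  case False
  then show ?thesis using le_rlimI[OF assms] mono_onD[OF mono] assms by simp
qed (simp add: rlim_def)

lemma mono_on_rlim: "mono_on I (rlim I f)"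
proof (rule mono_onI)
  fix s t assume "s \<in> I" "t \<in> I" "s \<le> t"
  then show "rlim I f s \<le> rlim I f t"
    using order_trans[OF rlim_le[of t s] le_rlim[of t]] by (cases "s = t") simp_all
qed

text \<open>Right continuity in the order form in which \<open>stieltjes_measure_exists\<close>
  consumes it. The point \<open>t\<close> only ensures that there is room in \<open>I\<close> to the
  right of \<open>x\<close>.\<close>

lemma rlim_right_continuous:
  assumes "x \<in> I" "t \<in> I" "x < t" "rlim I f x < y"
  obtains x' where "x' \<in> I" "x < x'" "rlim I f x' < y"
proof -
  have "\<not> is_right_end I x" using assms by (auto simp: is_right_end_def not_le)
  with le_rlimI[of x y] assms obtain z where z: "z \<in> I" "x < z" "f z < y"
    by (meson not_le)
  \<comment> \<open>The point \<open>z\<close> itself may fail, since the right limit at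
    \<open>z\<close> can exceed \<open>y\<close>; strictly left of \<open>z\<close> the right limit
    is bounded by \<open>f z\<close>.\<close>
  define x' where "x' = (x + z) / 2"
  have x': "x < x'" "x' < z" using z by (auto simp: x'_def)
  then have "x' \<in> I" using ivl assms z unfolding is_interval_1 by (meson less_imp_le)
  moreover have "rlim I f x' < y"
    using rlim_le[of z x'] \<open>x' \<in> I\<close> x' z by linarith
  ultimately show thesis using that x' by blast
qed

end

subsection \<open>Measures on an interval\<close>

text \<open>All types of intervals are treated at once by a countable subset that is cofinal in both
  directions: the rationals of \<open>J\<close> together with those endpoints that belong to
  \<open>J\<close>, which may be irrational and have nothing beyond them. Running minima and maxima
  of an enumeration give the bounds.\<close>

lemma interval_exhaustion:
  fixes J :: "real set"
  assumes "is_interval J" "J \<noteq> {}"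
  obtains a b :: "nat \<Rightarrow> real"
  where "\<And>n. a n \<in> J" "\<And>n. b n \<in> J" "\<And>n. a n \<le> b n" "decseq a" "incseq b" "J = (\<Union>n. {a n..b n})"
proof -
  define S where "S = (\<rat> \<inter> J) \<union> {x. is_left_end J x} \<union> {x. is_right_end J x}"
  have ends: "{x. is_left_end J x} \<subseteq> {Inf J}" "{x. is_right_end J x} \<subseteq> {Sup J}"
    by (auto simp: is_left_end_def is_right_end_def intro: cInf_eq_minimum[symmetric] cSup_eq_maximum[symmetric])
  have "countable S"
    unfolding S_def using ends countable_rat
    by (intro countable_Un) (auto intro: countable_subset)
  have "S \<subseteq> J" by (auto simp: S_def is_left_end_def is_right_end_def)
  have low: "\<exists>s\<in>S. s \<le> x" if "x \<in> J" for x
  proof (cases "is_left_end J x")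
    case False
    then obtain y where "y \<in> J" "y < x" using \<open>x \<in> J\<close> by (auto simp: is_left_end_def not_le)
    then obtain q where "q \<in> \<rat>" "y < q" "q < x" using Rats_dense_in_real by blast
    then show ?thesis
      using \<open>y \<in> J\<close> that assms(1) unfolding S_def is_interval_1 by (meson IntI UnI1 less_imp_le)
  qed (auto simp: S_def)
  have high: "\<exists>s\<in>S. x \<le> s" if "x \<in> J" for x
  proof (cases "is_right_end J x")
    case False
    then obtain y where "y \<in> J" "x < y" using \<open>x \<in> J\<close> by (auto simp: is_right_end_def not_le)
    then obtain q where "q \<in> \<rat>" "x < q" "q < y" using Rats_dense_in_real by blast
    then show ?thesis
      using \<open>y \<in> J\<close> that assms(1) unfolding S_def is_interval_1 by (meson IntI UnI1 less_imp_le)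
  qed (auto simp: S_def)
  have "S \<noteq> {}" using assms(2) low by blast
  define e where "e = from_nat_into S"
  have e: "range e = S" unfolding e_def by (rule range_from_nat_into) fact+
  define a b where "a n = Min (e ` {..n})" and "b n = Max (e ` {..n})" for n
  have "a n \<in> e ` {..n}" "b n \<in> e ` {..n}" for n
    unfolding a_def b_def by (rule Min_in Max_in; simp)+
  then have ab: "a n \<in> J" "b n \<in> J" for n
    using e \<open>S \<subseteq> J\<close> by blast+
  have ae: "a n \<le> e i" and eb: "e i \<le> b n" if "i \<le> n" for i n
    using that by (auto simp: a_def b_def)
  show thesis
  proof
    show "a n \<le> b n" for n using ae[of n n] eb[of n n] by simp
    show "decseq a" unfolding decseq_def a_def by (auto intro!: Min_antimono)
    show "incseq b" unfolding incseq_def b_def by (auto intro!: Max_mono)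
    show "J = (\<Union>n. {a n..b n})"
    proof (intro equalityI subsetI)
      fix x assume "x \<in> J"
      with low high e obtain i j where "e i \<le> x" "x \<le> e j" by (metis imageE)
      then have "x \<in> {a (max i j)..b (max i j)}"
        using ae[of i "max i j"] eb[of j "max i j"] by auto
      then show "x \<in> (\<Union>n. {a n..b n})" by blast
    next
      fix x assume "x \<in> (\<Union>n. {a n..b n})"
      then obtain n where "a n \<le> x" "x \<le> b n" by auto
      then show "x \<in> J" using ab[of n] assms(1) unfolding is_interval_1 by blast
    qed
  qed (use ab in auto)
qed

lemma interval_in_sets:
  fixes I :: "real set"
  assumes "sets M = sets (restrict_space borel I)" "is_interval I" "is_interval J" "J \<subseteq> I"
  shows "J \<in> sets M"
  using assms real_interval_borel_measurable by (simp add: sets_restrict_space_iff)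

text \<open>The supremum is over an uncountable family, but a countable increasing exhaustion inside
  it already reaches the measure by continuity from below.\<close>

lemma emeasure_interval_eq_SUP:
  fixes I :: "real set"
  assumes M: "sets M = sets (restrict_space borel I)" and I: "is_interval I" and J: "is_interval J" "J \<subseteq> I"
  shows "emeasure M J = (SUP (a, b)\<in>{(a, b). a \<in> J \<and> b \<in> J \<and> a \<le> b}. emeasure M {a..b})"
    (is "_ = ?S")
proof (cases "J = {}")
  case False
  obtain a b :: "nat \<Rightarrow> real"
    where ab: "\<And>n. a n \<in> J" "\<And>n. b n \<in> J" "\<And>n. a n \<le> b n" "decseq a" "incseq b"
      and Jeq: "J = (\<Union>n. {a n..b n})"
    by (rule interval_exhaustion[OF J(1) False]) (rule that; assumption)
  have sub: "{x..y} \<subseteq> J" if "x \<in> J" "y \<in> J" for x y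
    using that J by (intro Icc_subset_interval)
  have sets: "{x..y} \<in> sets M" if "x \<in> J" "y \<in> J" for x y
    using sub[OF that] J by (intro interval_in_sets[OF M I]) auto
  show ?thesis
  proof (rule antisym)
    have "incseq (\<lambda>n. {a n..b n})"
      using ab(4,5) by (auto simp: incseq_def decseq_def intro: order_trans)
    then have "emeasure M J = (SUP n. emeasure M {a n..b n})"
      unfolding Jeq using sets ab by (intro SUP_emeasure_incseq[symmetric]) auto
    also have "\<dots> \<le> ?S"
      by (rule SUP_least) (use ab in \<open>auto intro!: SUP_upper2[of "(a n, b n)" for n]\<close>)
    finally show "emeasure M J \<le> ?S" .
    show "?S \<le> emeasure M J"
      using sub interval_in_sets[OF M I J] by (auto intro!: SUP_least emeasure_mono)
  qed
qed (simp add: bot_ennreal)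

lemma sigma_sets_Icc:
  fixes I :: "real set"
  assumes I: "is_interval I"
  shows "sigma_sets I {{s..t} | s t. {s..t} \<subseteq> I} = sets (restrict_space borel I)" (is "sigma_sets I ?E = ?B")
proof
  have "sigma_sets (space (restrict_space borel I)) ?E \<subseteq> ?B"
    by (rule sets.sigma_sets_subset) (auto intro!: interval_in_sets[OF refl I])
  then show "sigma_sets I ?E \<subseteq> ?B" by (simp add: space_restrict_space)
  have "I \<in> sigma_sets UNIV (range (\<lambda>a::real. {..a}))"
    using real_interval_borel_measurable[OF I] by (simp add: borel_eq_atMost)
  moreover have "?B = (\<inter>) I ` sigma_sets UNIV (range (\<lambda>a::real. {..a}))"
    unfolding sets_restrict_space by (simp add: borel_eq_atMost)
  ultimately have "?B = sigma_sets I ((\<inter>) I ` range (\<lambda>a::real. {..a}))"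
    by (simp add: sigma_sets_Int)
  also have "\<dots> \<subseteq> sigma_sets I ?E"
  proof (rule sigma_sets_mono, clarify)
    fix x :: real
    \<comment> \<open>The traces of the rays generate the Borel sets of \<open>I\<close>, and each
      trace is an interval, hence a countable union of compact intervals.\<close>
    show "I \<inter> {..x} \<in> sigma_sets I ?E"
    proof (cases "I \<inter> {..x} = {}")
      case False
      have J: "is_interval (I \<inter> {..x})" using I by (intro is_interval_Int) auto
      obtain a b :: "nat \<Rightarrow> real" where ab: "\<And>n. a n \<in> I \<inter> {..x}" "\<And>n. b n \<in> I \<inter> {..x}"
          and eq: "I \<inter> {..x} = (\<Union>n. {a n..b n})"
        using interval_exhaustion[OF J False] by metis
      have "{a n..b n} \<in> ?E" for n
        using eq by blast
      then show ?thesis unfolding eq by (intro sigma_sets.Union) auto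
    qed (auto intro: sigma_sets.Empty)
  qed
  finally show "?B \<subseteq> sigma_sets I ?E" .
qed

text \<open>Finite mass on compact intervals and the exhaustion of \<open>I\<close> provide the
  sigma-finiteness for uniqueness on an intersection-stable generator. It serves both for the
  \<open>THE\<close> in \<open>stieltjes_measure\<close> and for the uniqueness of \<nu>.\<close>

lemma measure_eqI_Icc:
  fixes I :: "real set"
  assumes I: "is_interval I" "I \<noteq> {}"
    and M: "sets M = sets (restrict_space borel I)" and N: "sets N = sets (restrict_space borel I)"
    and eq: "\<And>s t. s \<in> I \<Longrightarrow> t \<in> I \<Longrightarrow> s \<le> t \<Longrightarrow> emeasure M {s..t} = emeasure N {s..t}"
    and fin: "\<And>s t. s \<in> I \<Longrightarrow> t \<in> I \<Longrightarrow> s \<le> t \<Longrightarrow> emeasure M {s..t} < \<infinity>"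
  shows "M = N"
proof -
  obtain a b :: "nat \<Rightarrow> real" where ab: "\<And>n. a n \<in> I" "\<And>n. b n \<in> I" "\<And>n. a n \<le> b n"
    and Ieq: "I = (\<Union>n. {a n..b n})"
    using interval_exhaustion[OF I] by metis
  show ?thesis
  proof (rule measure_eqI_generator_eq[of "{{s..t} | s t. {s..t} \<subseteq> I}" I M N "\<lambda>n. {a n..b n}"])
    show "Int_stable {{s..t} | s t. {s..t} \<subseteq> I}"
    proof (rule Int_stableI)
      fix A B assume "A \<in> {{s..t} | s t. {s..t} \<subseteq> I}" "B \<in> {{s..t} | s t. {s..t} \<subseteq> I}"
      then obtain s t s' t' where *: "A = {s..t}" "B = {s'..t'}" "A \<subseteq> I" by blast
      \<comment> \<open>Disjoint \<open>A\<close> and \<open>B\<close> cause no exception: the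
        generator does not require \<open>s \<le> t\<close>, so it contains the empty set.\<close>
      then have "A \<inter> B = {max s s'..min t t'}" "A \<inter> B \<subseteq> I" by auto
      then show "A \<inter> B \<in> {{s..t} | s t. {s..t} \<subseteq> I}" by (metis (mono_tags, lifting) mem_Collect_eq)
    qed
    fix X assume "X \<in> {{s..t} | s t. {s..t} \<subseteq> I}"
    then obtain s t where X: "X = {s..t}" "X \<subseteq> I" by blast
    show "emeasure M X = emeasure N X"
      using X eq[of s t] by (cases "s \<le> t") (auto simp: subset_iff)
  qed (use I ab Ieq M N sigma_sets_Icc[OF I(1)] fin in \<open>auto simp: less_top\<close>)
qed

subsection \<open>The Stieltjes measure\<close>

text \<open>The measure is the image of Lebesgue measure under the generalised inverse of \<open>v\<close>, so that no
  exhaustion of \<open>I\<close> by intervals on which \<open>v\<close> is bounded is needed.\<close>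

lemma stieltjes_measure_exists:
  fixes I :: "real set"
  assumes I: "is_interval I" and mono: "mono_on I v"
    and rc: "\<And>x t y. x \<in> I \<Longrightarrow> t \<in> I \<Longrightarrow> x < t \<Longrightarrow> v x < y \<Longrightarrow> \<exists>x'\<in>I. x < x' \<and> v x' < y"
  obtains \<mu> :: "real measure" where "sets \<mu> = sets (restrict_space borel I)"
    "\<And>s t. s \<in> I \<Longrightarrow> t \<in> I \<Longrightarrow> s \<le> t \<Longrightarrow> emeasure \<mu> {s<..t} = ennreal (v t - v s)"
    "\<And>a. is_left_end I a \<Longrightarrow> emeasure \<mu> {a} = 0"
proof -
  \<comment> \<open>\<open>D\<close> is the union of the \<open>{v s<..v t}\<close>: at these
    heights the set defining \<open>g\<close> is nonempty and bounded below. The strict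
    \<open>v s < y\<close> excludes heights up to the value of \<open>v\<close> at a left endpoint,
    which is why that point gets mass 0.\<close>
  define D where "D = {y. \<exists>s\<in>I. \<exists>t\<in>I. v s < y \<and> y \<le> v t}"
  define g where "g y = Inf {x \<in> I. y \<le> v x}" for y
  have v_less: "s < x" if "s \<in> I" "x \<in> I" "v s < v x" for s x
    using mono_onD[OF mono, of x s] that by (meson leD le_less_linear)
  have D_bdd: "bdd_below {x \<in> I. y \<le> v x}" if "y \<in> D" for y
  proof -
    from that obtain s where "s \<in> I" "v s < y" by (auto simp: D_def)
    then show ?thesis
      using v_less by (intro bdd_belowI[of _ s]) (force intro: less_imp_le)
  qed
  have D_ne: "{x \<in> I. y \<le> v x} \<noteq> {}" if "y \<in> D" for y
    using that by (auto simp: D_def)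
  \<comment> \<open>Right continuity enters here: if \<open>v x < y\<close>, then
    \<open>v x' < y\<close> for some \<open>x' > x\<close>, and monotonicity makes \<open>x'\<close>
    a lower bound of the set defining \<open>g y\<close>, so \<open>g y > x\<close>.\<close>
  have g_le: "g y \<le> x \<longleftrightarrow> y \<le> v x" if y: "y \<in> D" and x: "x \<in> I" for x y
  proof
    assume "y \<le> v x"
    then show "g y \<le> x" unfolding g_def using D_bdd[OF y] x by (intro cInf_lower) auto
  next
    assume le: "g y \<le> x"
    show "y \<le> v x"
    proof (rule ccontr)
      assume "\<not> y \<le> v x"
      moreover obtain t where "t \<in> I" "y \<le> v t" using y by (auto simp: D_def)
      moreover have "x < t" using calculation x v_less[of x t] by linarith
      ultimately obtain x' where x': "x' \<in> I" "x < x'" "v x' < y"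
        using rc[of x t y] x by auto
      have "x' \<le> g y"
        unfolding g_def using D_ne[OF y] x' v_less
        by (intro cInf_greatest) (force intro: less_imp_le)+
      with le x' show False by linarith
    qed
  qed
  have g_in: "g y \<in> I" if "y \<in> D" for y
  proof -
    from that obtain s t where st: "s \<in> I" "t \<in> I" "v s < y" "y \<le> v t" by (auto simp: D_def)
    then have "g y \<le> t" "s < g y" using g_le[OF that] by (auto simp flip: not_le)
    then show ?thesis using I st unfolding is_interval_1 by (meson less_imp_le)
  qed
  have "is_interval D"
    unfolding is_interval_1 D_def by (blast intro: less_le_trans order_trans)
  then have D: "D \<in> sets borel" by (rule real_interval_borel_measurable)
  have "mono_on D g"
  proof (rule mono_onI)
    fix y z assume "y \<in> D" "z \<in> D" "y \<le> z"
    moreover have "z \<le> v (g z)" using g_le[of z "g z"] g_in calculation by blast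
    ultimately show "g y \<le> g z" using g_le[of y "g z"] g_in by auto
  qed
  then have "g \<in> borel_measurable (restrict_space borel D)" by (rule borel_measurable_mono_on_fnc)
  then have "g \<in> borel_measurable (restrict_space lborel D)"
    by (simp cong: measurable_cong_sets add: sets_restrict_space)
  then have g: "g \<in> measurable (restrict_space lborel D) (restrict_space borel I)"
    using g_in by (intro measurable_restrict_space2) (auto simp: space_restrict_space)
  define \<mu> where "\<mu> = distr (restrict_space lborel D) (restrict_space borel I) g"
  have \<mu>: "emeasure \<mu> X = emeasure lborel {y \<in> D. g y \<in> X}"
    if "X \<in> sets (restrict_space borel I)" for X
  proof -
    have "emeasure \<mu> X = emeasure (restrict_space lborel D) (g -` X \<inter> space (restrict_space lborel D))"
      unfolding \<mu>_def by (rule emeasure_distr) (use g that in auto)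
    also have "g -` X \<inter> space (restrict_space lborel D) = {y \<in> D. g y \<in> X}"
      by (auto simp: space_restrict_space)
    finally show ?thesis using D by (simp add: emeasure_restrict_space)
  qed
  show thesis
  proof
    show "sets \<mu> = sets (restrict_space borel I)" by (simp add: \<mu>_def)
  next
    fix s t assume st: "s \<in> I" "t \<in> I" "s \<le> t"
    have "{s<..t} \<subseteq> I" using Icc_subset_interval[OF I, of s t] st by auto
    then have "emeasure \<mu> {s<..t} = emeasure lborel {y \<in> D. g y \<in> {s<..t}}"
      by (intro \<mu> interval_in_sets[OF refl I]) (auto simp: is_interval_1)
    also have "{y \<in> D. g y \<in> {s<..t}} = {v s<..v t}"
    proof -
      have "g y \<in> {s<..t} \<longleftrightarrow> y \<in> {v s<..v t}" if "y \<in> D" for y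
        using g_le[OF that st(1)] g_le[OF that st(2)] by auto
      moreover have "{v s<..v t} \<subseteq> D" using st by (auto simp: D_def)
      ultimately show ?thesis by blast
    qed
    also have "emeasure lborel \<dots> = ennreal (v t - v s)"
      using mono_onD[OF mono] st by simp
    finally show "emeasure \<mu> {s<..t} = ennreal (v t - v s)" .
  next
    fix a assume a: "is_left_end I a"
    then have aI: "a \<in> I" by (simp add: is_left_end_def)
    have "emeasure \<mu> {a} = emeasure lborel {y \<in> D. g y \<in> {a}}"
      using aI by (intro \<mu> interval_in_sets[OF refl I]) (auto simp: is_interval_1)
    also have "{y \<in> D. g y \<in> {a}} = {}"
    proof -
      have False if y: "y \<in> D" "g y = a" for y
      proof -
        obtain s where s: "s \<in> I" "v s < y" using y by (auto simp: D_def)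
        have "y \<le> v a" using g_le[of y a] y aI by simp
        also have "v a \<le> v s" using a s mono_onD[OF mono] by (simp add: is_left_end_def)
        finally show False using s by simp
      qed
      then show ?thesis by auto
    qed
    finally show "emeasure \<mu> {a} = 0" by simp
  qed
qed

context
  fixes I :: "real set" and f :: "real \<Rightarrow> real"
  assumes ivl: "is_interval I" "I \<noteq> {}" and mono: "mono_on I f"
begin

text \<open>\<open>{s..t}\<close> is a decreasing intersection of sets \<open>{x n<..t}\<close> of
  finite mass with \<open>x n\<close> increasing to \<open>s\<close>, and the right limits of
  \<open>f\<close> at \<open>x n\<close> converge to its left limit at \<open>s\<close>.\<close>

lemma emeasure_Icc_of_Ioc:
  assumes M: "sets M = sets (restrict_space borel I)"
    and Ioc: "\<And>s t. s \<in> I \<Longrightarrow> t \<in> I \<Longrightarrow> s \<le> t \<Longrightarrow> emeasure M {s<..t} = ennreal (rlim I f t - rlim I f s)"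
    and st: "s \<in> I" "t \<in> I" "s \<le> t" and left: "\<not> is_left_end I s"
  shows "emeasure M {s..t} = ennreal (rlim I f t - llim I f s)"
proof -
  obtain r where r: "r \<in> I" "r < s" using left st by (auto simp: is_left_end_def not_le)
  \<comment> \<open>The sequence starts at \<open>r\<close>, so it stays in \<open>I\<close>, and it
    remains strictly below \<open>s\<close>, so \<open>s\<close> survives in the
    intersection.\<close>
  define x where "x n = s - (s - r) / real (Suc n)" for n
  have x_less: "x n < s" and x_ge: "r \<le> x n" for n
  proof -
    show "x n < s" using r by (simp add: x_def)
    have "(s - r) / real (Suc n) \<le> s - r" using r by (simp add: divide_le_eq)
    then show "r \<le> x n" by (simp add: x_def)
  qed
  have xI: "x n \<in> I" for n using ivl(1) r st x_less[of n] x_ge[of n] unfolding is_interval_1 by (meson less_imp_le)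
  have x_mono: "incseq x"
    using r by (auto simp: incseq_def x_def intro!: divide_left_mono)
  have x_lim: "x \<longlonglongrightarrow> s" unfolding x_def
    using tendsto_diff[OF tendsto_const LIMSEQ_Suc[OF lim_const_over_n[of "s - r"]], of s] by simp
  have sets: "{x n<..t} \<in> sets M" for n
    using Icc_subset_interval[OF ivl(1) xI st(2), of n]
    by (intro interval_in_sets[OF M ivl(1)]) (auto simp: is_interval_1)
  have Ioc_x: "emeasure M {x n<..t} = ennreal (rlim I f t - rlim I f (x n))" for n
    using xI st x_less[of n] by (intro Ioc) auto
  have "decseq (\<lambda>n. {x n<..t})"
    unfolding decseq_def
  proof (intro allI impI subsetI)
    fix m n y assume "m \<le> n" "y \<in> {x n<..t}"
    then show "y \<in> {x m<..t}" using incseqD[OF x_mono, of m n] by auto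
  qed
  then have "(\<lambda>n. emeasure M {x n<..t}) \<longlonglongrightarrow> emeasure M (\<Inter>n. {x n<..t})"
    using sets Ioc_x by (intro Lim_emeasure_decseq) auto
  also have "(\<Inter>n. {x n<..t}) = {s..t}"
  proof (intro equalityI subsetI)
    fix y assume y: "y \<in> (\<Inter>n. {x n<..t})"
    then have "s \<le> y" by (intro LIMSEQ_le_const2[OF x_lim]) (auto intro: less_imp_le)
    then show "y \<in> {s..t}" using y by auto
  qed (use x_less in \<open>auto intro: less_le_trans\<close>)
  finally have lim: "(\<lambda>n. ennreal (rlim I f t - rlim I f (x n))) \<longlonglongrightarrow> emeasure M {s..t}"
    by (simp only: Ioc_x)
  have f_lim: "(\<lambda>n. f (x n)) \<longlonglongrightarrow> llim I f s"
    by (rule filterlim_compose[OF tendsto_llim[OF ivl(1) mono st(1)]])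
      (use x_less xI x_lim in \<open>auto simp: filterlim_at less_imp_neq\<close>)
  have "(\<lambda>n. rlim I f (x n)) \<longlonglongrightarrow> llim I f s"
  proof (rule tendsto_sandwich[OF _ _ f_lim tendsto_const])
    show "eventually (\<lambda>n. f (x n) \<le> rlim I f (x n)) sequentially"
      using le_rlim[OF ivl(1) mono xI] by simp
    have "rlim I f (x n) \<le> llim I f s" for n
    proof -
      \<comment> \<open>A point strictly between \<open>x n\<close> and \<open>s\<close> separates
        the two limits: the right limit at \<open>x n\<close> is at most \<open>f z\<close>, which
        is at most the left limit at \<open>s\<close>.\<close>
      define z where "z = (x n + s) / 2"
      have z: "x n < z" "z < s" using x_less[of n] by (auto simp: z_def)
      then have "z \<in> I" using ivl(1) xI[of n] st unfolding is_interval_1 by (meson less_imp_le)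
      then show ?thesis
        using rlim_le[OF ivl(1) mono _ xI z(1)] le_llim[OF ivl(1) mono _ st(1) z(2)] by force
    qed
    then show "eventually (\<lambda>n. rlim I f (x n) \<le> llim I f s) sequentially" by simp
  qed
  then have "(\<lambda>n. ennreal (rlim I f t - rlim I f (x n))) \<longlonglongrightarrow> ennreal (rlim I f t - llim I f s)"
    by (intro tendsto_ennrealI tendsto_intros)
  with lim show ?thesis by (rule LIMSEQ_unique)
qed

text \<open>The \<open>THE\<close> in the definition has content only after existence and
  uniqueness. For uniqueness the masses of compact intervals are computed from the three conditions;
  the one on the left endpoint settles the intervals starting there.\<close>

lemma stieltjes_measure_rlim:
  shows sets_stieltjes_measure: "sets (stieltjes_measure I (rlim I f)) = sets (restrict_space borel I)"
    and emeasure_stieltjes_measure_Ioc: "\<And>s t. s \<in> I \<Longrightarrow> t \<in> I \<Longrightarrow> s \<le> t \<Longrightarrow>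
      emeasure (stieltjes_measure I (rlim I f)) {s<..t} = ennreal (rlim I f t - rlim I f s)"
    and emeasure_stieltjes_measure_left_end: "\<And>a. is_left_end I a \<Longrightarrow> emeasure (stieltjes_measure I (rlim I f)) {a} = 0"
proof -
  define P where "P \<mu> \<longleftrightarrow> sets \<mu> = sets (restrict_space borel I) \<and>
     (\<forall>s\<in>I. \<forall>t\<in>I. s \<le> t \<longrightarrow> emeasure \<mu> {s<..t} = ennreal (rlim I f t - rlim I f s)) \<and>
     (\<forall>a. is_left_end I a \<longrightarrow> emeasure \<mu> {a} = 0)" for \<mu>
  obtain \<mu> where \<mu>: "P \<mu>"
    using stieltjes_measure_exists[OF ivl(1) mono_on_rlim[OF ivl(1) mono]]
      rlim_right_continuous[OF ivl(1) mono] unfolding P_def by metis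
  have Icc: "emeasure N {s..t} = (if is_left_end I s then ennreal (rlim I f t - rlim I f s)
      else ennreal (rlim I f t - llim I f s))" if N: "P N" and st: "s \<in> I" "t \<in> I" "s \<le> t" for N s t
  proof (cases "is_left_end I s")
    case True
    have NI: "sets N = sets (restrict_space borel I)" using N by (simp add: P_def)
    have "{s} \<in> sets N" "{s<..t} \<in> sets N"
      using Icc_subset_interval[OF ivl(1) st(1,2)] st
      by (auto intro!: interval_in_sets[OF NI ivl(1)] simp: is_interval_1)
    then have "emeasure N ({s} \<union> {s<..t}) = emeasure N {s} + emeasure N {s<..t}"
      by (intro plus_emeasure[symmetric]) auto
    also have "{s} \<union> {s<..t} = {s..t}" using st by auto
    finally show ?thesis using True N st by (simp add: P_def)
  next
    case False
    then show ?thesis using emeasure_Icc_of_Ioc[of N s t] N st by (simp add: P_def)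
  qed
  have "N = \<mu>" if "P N" for N
    by (rule measure_eqI_Icc[OF ivl]) (use that \<mu> Icc[OF that] Icc[OF \<mu>] in \<open>auto simp: P_def\<close>)
  then have "P (stieltjes_measure I (rlim I f))"
    unfolding stieltjes_measure_def P_def[symmetric] using \<mu> by (metis theI)
  then show "sets (stieltjes_measure I (rlim I f)) = sets (restrict_space borel I)"
    "\<And>s t. s \<in> I \<Longrightarrow> t \<in> I \<Longrightarrow> s \<le> t \<Longrightarrow>
      emeasure (stieltjes_measure I (rlim I f)) {s<..t} = ennreal (rlim I f t - rlim I f s)"
    "\<And>a. is_left_end I a \<Longrightarrow> emeasure (stieltjes_measure I (rlim I f)) {a} = 0"
    unfolding P_def by blast+
qed

end


subsection \<open>The speed measure\<close>

lemma left_end_eq_Inf: "is_left_end I a \<Longrightarrow> a = Inf I"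
  unfolding is_left_end_def by (rule cInf_eq_minimum[symmetric]) blast+

lemma sets_speed_measure: "sets (speed_measure I \<gamma> c) = sets (restrict_space borel I)"
proof -
  have "sigma_sets I (sets (restrict_space borel I)) = sets (restrict_space borel I)"
    using sets.sigma_sets_eq[of "restrict_space borel I"] by (simp add: space_restrict_space)
  moreover have "sets (restrict_space borel I) \<subseteq> Pow I"
    using sets.space_closed[of "restrict_space borel I"] by (simp add: space_restrict_space)
  ultimately show ?thesis by (simp add: speed_measure_def Let_def)
qed

text \<open>\<open>measure_of\<close> falls back to the zero measure unless the given set function
  is a measure, so countable additivity has to be checked before the formula may be used.\<close>

lemma emeasure_measure_of_add_point_mass:
  assumes A: "A \<in> sets M"
  shows "emeasure (measure_of (space M) (sets M) (\<lambda>A. emeasure M A + k * indicator A a)) A =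
    emeasure M A + k * indicator A a"
proof (rule emeasure_measure_of[OF refl])
  show "sets M \<subseteq> Pow (space M)" by (rule sets.space_closed)
  let ?N = "measure_of (space M) (sets M) (\<lambda>A. emeasure M A + k * indicator A a)"
  show "A \<in> sets ?N" using A by simp
  show "positive (sets ?N) (\<lambda>A. emeasure M A + k * indicator A a)"
    by (simp add: positive_def)
  show "countably_additive (sets ?N) (\<lambda>A. emeasure M A + k * indicator A a)"
  proof (rule countably_additiveI)
    fix F :: "nat \<Rightarrow> _" assume F: "range F \<subseteq> sets ?N" "disjoint_family F"
    have "(\<Sum>i. emeasure M (F i) + k * indicator (F i) a) =
        (\<Sum>i. emeasure M (F i)) + (\<Sum>i. k * indicator (F i) a)"
      by (intro suminf_add[symmetric]) auto
    then show "(\<Sum>i. emeasure M (F i) + k * indicator (F i) a) = emeasure M (\<Union>i. F i) + k * indicator (\<Union>i. F i) a"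
      using F by (simp add: suminf_emeasure suminf_indicator)
  qed
qed

section \<open>Increments and minimality of the variation function\<close>

locale locally_bv_path =
  fixes I :: "real set" and \<gamma> :: "real \<Rightarrow> 'a::metric_space" and c :: real
  assumes ivl: "is_interval I" and bv: "locally_bounded_variation I \<gamma>" and c: "c \<in> I"
begin

abbreviation "V \<equiv> variation_fun \<gamma> c"
abbreviation "\<nu> \<equiv> speed_measure I \<gamma> c"

lemma variation_finite: "a \<in> I \<Longrightarrow> b \<in> I \<Longrightarrow> variation \<gamma> {a..b} < \<infinity>"
  using bv unfolding locally_bounded_variation_def by (cases "a \<le> b") simp_all

lemma variation_fun_diff:
  assumes "a \<in> I" "b \<in> I" "a \<le> b"
  shows "V b - V a = enn2real (variation \<gamma> {a..b})"
proof -
  have add: "enn2real (variation \<gamma> {x..z}) = enn2real (variation \<gamma> {x..y}) + enn2real (variation \<gamma> {y..z})"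
    if "x \<in> I" "z \<in> I" "x \<le> y" "y \<le> z" for x y z
    using that variation_finite by (intro variation_real_additive)
  consider "c \<le> a" | "a < c" "c \<le> b" | "b < c" by linarith
  then show ?thesis
  proof cases
    case 1
    then show ?thesis using add[of c b a] assms c by (simp add: variation_fun_def)
  next
    case 2
    then show ?thesis using add[of a b c] assms c by (simp add: variation_fun_def)
  next
    case 3
    then show ?thesis using add[of a c b] assms c by (simp add: variation_fun_def)
  qed
qed

lemma variation_Icc:
  assumes "a \<in> I" "b \<in> I" "a \<le> b"
  shows "variation \<gamma> {a..b} = ennreal (V b - V a)"
  using variation_finite[OF assms(1,2)] by (simp add: variation_fun_diff[OF assms] less_top)

lemma variation_fun_mono: "mono_on I V"
proof (rule mono_onI)
  fix a b assume "a \<in> I" "b \<in> I" "a \<le> b"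
  then show "V a \<le> V b" using variation_fun_diff[of a b] enn2real_nonneg[of "variation \<gamma> {a..b}"] by linarith
qed

lemma dist_le_variation_fun:
  assumes "a \<in> I" "b \<in> I" "a \<le> b"
  shows "dist (\<gamma> a) (\<gamma> b) \<le> V b - V a"
proof -
  have "ennreal (dist (\<gamma> a) (\<gamma> b)) \<le> ennreal (V b - V a)"
    using dist_le_variation[of a "{a..b}" b \<gamma>] assms by (simp add: variation_Icc)
  then show ?thesis
    using mono_onD[OF variation_fun_mono assms] by (simp add: ennreal_le_iff)
qed

lemma variation_fun_le_of_dominated:
  assumes "a \<in> I" "b \<in> I" "a \<le> b"
    and dom: "\<And>x y. a \<le> x \<Longrightarrow> x \<le> y \<Longrightarrow> y \<le> b \<Longrightarrow> dist (\<gamma> x) (\<gamma> y) \<le> W y - W x"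
  shows "V b - V a \<le> W b - W a"
proof -
  have "ennreal (V b - V a) \<le> ennreal (W b - W a)"
    using variation_le_of_dominated[of a b \<gamma> W] dom assms by (simp add: variation_Icc)
  \<comment> \<open>\<open>ennreal\<close> truncates negative numbers to 0, so the inequality
    returns to the reals only once the right-hand side is known to be nonnegative.\<close>
  moreover have "0 \<le> W b - W a"
    using dom[of a b] assms(3) zero_le_dist[of "\<gamma> a" "\<gamma> b"] by linarith
  ultimately show ?thesis by (simp add: ennreal_le_iff)
qed

text \<open>If \<open>dist (\<gamma> t) (\<gamma> s)\<close> fell short of \<open>V s - V t\<close> by \<open>e\<close> for \<open>s\<close> arbitrarily close to \<open>t\<close>, then
  lowering \<open>V\<close> by \<open>e\<close> beyond \<open>t\<close> would still dominate the distances, so \<open>V\<close> would not be minimal.\<close>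

lemma dist_ge_right:
  assumes t: "t \<in> I" and e: "e > 0"
  shows "\<exists>y>t. \<forall>s\<in>I. t < s \<longrightarrow> s < y \<longrightarrow> V s - V t - e < dist (\<gamma> t) (\<gamma> s)"
proof (rule ccontr)
  assume *: "\<not> ?thesis"
  have ex: "\<exists>s\<in>I. t < s \<and> s < y \<and> dist (\<gamma> t) (\<gamma> s) \<le> V s - V t - e" if "t < y" for y
    using * that by (meson not_less)
  \<comment> \<open>The negated claim itself yields points of \<open>I\<close> to the right of
    \<open>t\<close>, so a right endpoint needs no separate treatment.\<close>
  obtain b where b: "b \<in> I" "t < b" using ex[of "t + 1"] by auto
  have sub: "{t..b} \<subseteq> I" using Icc_subset_interval[OF ivl t b(1)] .
  define W where "W x = (if x \<le> t then V x else V x - e)" for x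
  have "V b - V t \<le> W b - W t"
  proof (rule variation_fun_le_of_dominated)
    fix x y assume xy: "t \<le> x" "x \<le> y" "y \<le> b"
    then have I: "x \<in> I" "y \<in> I" using sub by auto
    show "dist (\<gamma> x) (\<gamma> y) \<le> W y - W x"
    \<comment> \<open>Only pairs that start at \<open>t\<close> feel the drop by \<open>e\<close>;
      the deficit is found at some \<open>s\<close> between \<open>t\<close> and \<open>y\<close>,
      and the path through \<gamma>(s) carries it over to \<open>y\<close>.\<close>
    proof (cases "x = t \<and> t < y")
      case True
      then obtain s where s: "s \<in> I" "t < s" "s < y" "dist (\<gamma> t) (\<gamma> s) \<le> V s - V t - e"
        using ex[of y] by auto
      have "dist (\<gamma> t) (\<gamma> y) \<le> dist (\<gamma> t) (\<gamma> s) + dist (\<gamma> s) (\<gamma> y)" by (rule dist_triangle)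
      then show ?thesis
        using dist_le_variation_fun[of s y] s I True by (simp add: W_def)
    next
      case False
      then show ?thesis using dist_le_variation_fun[OF I xy(2)] xy by (cases "x = t") (auto simp: W_def)
    qed
  qed (use t b in auto)
  then show False using b e by (simp add: W_def)
qed

text \<open>Mirror image of \<open>dist_ge_right\<close>: V is lowered by \<open>e\<close> at
  \<open>t\<close> alone, so the critical pairs are those that end at \<open>t\<close>.\<close>

lemma dist_ge_left:
  assumes t: "t \<in> I" and e: "e > 0"
  shows "\<exists>y<t. \<forall>s\<in>I. s < t \<longrightarrow> y < s \<longrightarrow> V t - V s - e < dist (\<gamma> s) (\<gamma> t)"
proof (rule ccontr)
  assume *: "\<not> ?thesis"
  have ex: "\<exists>s\<in>I. s < t \<and> y < s \<and> dist (\<gamma> s) (\<gamma> t) \<le> V t - V s - e" if "y < t" for y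
    using * that by (meson not_less)
  obtain b where b: "b \<in> I" "b < t" using ex[of "t - 1"] by auto
  have sub: "{b..t} \<subseteq> I" using Icc_subset_interval[OF ivl b(1) t] .
  define W where "W x = (if x < t then V x else V x - e)" for x
  have "V t - V b \<le> W t - W b"
  proof (rule variation_fun_le_of_dominated)
    fix x y assume xy: "b \<le> x" "x \<le> y" "y \<le> t"
    then have I: "x \<in> I" "y \<in> I" using sub by auto
    show "dist (\<gamma> x) (\<gamma> y) \<le> W y - W x"
    proof (cases "x < t \<and> y = t")
      case True
      then obtain s where s: "s \<in> I" "s < t" "x < s" "dist (\<gamma> s) (\<gamma> t) \<le> V t - V s - e"
        using ex[of x] by auto
      have "dist (\<gamma> x) (\<gamma> t) \<le> dist (\<gamma> x) (\<gamma> s) + dist (\<gamma> s) (\<gamma> t)" by (rule dist_triangle)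
      then show ?thesis
        using dist_le_variation_fun[of x s] s I True by (simp add: W_def)
    next
      case False
      then show ?thesis using dist_le_variation_fun[OF I xy(2)] xy by (cases "y = t") (auto simp: W_def)
    qed
  qed (use t b in auto)
  then show False using b e by (simp add: W_def)
qed

section \<open>Jumps of V and of \<gamma>, and continuity\<close>

text \<open>The defect \<open>V s - V t - dist (\<gamma> t) (\<gamma> s)\<close> is nonnegative
  because V dominates distances, and eventually below any \<open>e\<close> by
  \<open>dist_ge_right\<close>; hence the distance inherits the limit of
  \<open>V s - V t\<close>.\<close>

lemma tendsto_right_jump:
  assumes t: "t \<in> I"
  shows "((\<lambda>s. dist (\<gamma> t) (\<gamma> s)) \<longlongrightarrow> rlim I V t - V t) (at t within I \<inter> {t<..})"
proof -
  have "((\<lambda>s. V s - V t - dist (\<gamma> t) (\<gamma> s)) \<longlongrightarrow> 0) (at t within I \<inter> {t<..})"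
  proof (rule tendstoI)
    fix e :: real assume "e > 0"
    from dist_ge_right[OF t this] obtain y
      where y: "t < y" "\<forall>s\<in>I. t < s \<longrightarrow> s < y \<longrightarrow> V s - V t - e < dist (\<gamma> t) (\<gamma> s)"
      by auto
    have "dist (V s - V t - dist (\<gamma> t) (\<gamma> s)) 0 < e" if "s \<in> {..<y}" "s \<in> I \<inter> {t<..}" for s
    proof -
      have s: "s \<in> I" "t < s" "s < y" using that by simp_all
      with y(2) have "V s - V t - e < dist (\<gamma> t) (\<gamma> s)" by blast
      moreover have "dist (\<gamma> t) (\<gamma> s) \<le> V s - V t"
        using s by (intro dist_le_variation_fun t) simp_all
      ultimately show ?thesis unfolding dist_real_def by linarith
    qed
    then show "eventually (\<lambda>s. dist (V s - V t - dist (\<gamma> t) (\<gamma> s)) 0 < e) (at t within I \<inter> {t<..})"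
      unfolding eventually_at_topological using y(1) by (intro exI[of _ "{..<y}"]) simp
  qed
  from tendsto_diff[OF tendsto_diff[OF tendsto_rlim[OF ivl variation_fun_mono t] tendsto_const[of "V t"]] this]
  show ?thesis by simp
qed

lemma tendsto_left_jump:
  assumes t: "t \<in> I"
  shows "((\<lambda>s. dist (\<gamma> s) (\<gamma> t)) \<longlongrightarrow> V t - llim I V t) (at t within I \<inter> {..<t})"
proof -
  have "((\<lambda>s. V t - V s - dist (\<gamma> s) (\<gamma> t)) \<longlongrightarrow> 0) (at t within I \<inter> {..<t})"
  proof (rule tendstoI)
    fix e :: real assume "e > 0"
    from dist_ge_left[OF t this] obtain y
      where y: "y < t" "\<forall>s\<in>I. s < t \<longrightarrow> y < s \<longrightarrow> V t - V s - e < dist (\<gamma> s) (\<gamma> t)"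
      by auto
    have "dist (V t - V s - dist (\<gamma> s) (\<gamma> t)) 0 < e" if "s \<in> {y<..}" "s \<in> I \<inter> {..<t}" for s
    proof -
      have s: "s \<in> I" "s < t" "y < s" using that by simp_all
      with y(2) have "V t - V s - e < dist (\<gamma> s) (\<gamma> t)" by blast
      moreover have "dist (\<gamma> s) (\<gamma> t) \<le> V t - V s"
        using s by (intro dist_le_variation_fun t) simp_all
      ultimately show ?thesis unfolding dist_real_def by linarith
    qed
    then show "eventually (\<lambda>s. dist (V t - V s - dist (\<gamma> s) (\<gamma> t)) 0 < e) (at t within I \<inter> {..<t})"
      unfolding eventually_at_topological using y(1) by (intro exI[of _ "{y<..}"]) simp
  qed
  from tendsto_diff[OF tendsto_diff[OF tendsto_const[of "V t"] tendsto_llim[OF ivl variation_fun_mono t]] this]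
  show ?thesis by simp
qed

lemma right_jump_eq: "t \<in> I \<Longrightarrow> right_jump I \<gamma> t = rlim I V t - V t"
  unfolding right_jump_def
  by (rule rlim_eqI[OF ivl _ tendsto_right_jump]) (auto simp: rlim_def)

lemma left_jump_eq: "t \<in> I \<Longrightarrow> left_jump I \<gamma> t = V t - llim I V t"
  unfolding left_jump_def
  by (rule llim_eqI[OF ivl _ tendsto_left_jump]) (auto simp: llim_def)

text \<open>The punctured neighbourhoods of \<open>t\<close> in \<open>I\<close> split into a left
  and a right part. On each part \<gamma> tends to \<gamma>(t) iff the distance to \<gamma>(t) tends
  to 0, and the limit of that distance is the jump of V.\<close>

lemma continuous_on_iff_no_jumps:
  "continuous_on I \<gamma> \<longleftrightarrow> (\<forall>t\<in>I. llim I V t = V t \<and> rlim I V t = V t)"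
proof -
  have "(\<gamma> \<longlongrightarrow> \<gamma> t) (at t within I) \<longleftrightarrow> llim I V t = V t \<and> rlim I V t = V t" if t: "t \<in> I" for t
  proof -
    let ?L = "at t within I \<inter> {..<t}" and ?R = "at t within I \<inter> {t<..}"
    have dist_swap: "(\<lambda>s. dist (\<gamma> t) (\<gamma> s)) = (\<lambda>s. dist (\<gamma> s) (\<gamma> t))"
      by (rule ext) (rule dist_commute)
    have "at t within I = at t within (I - {t})" by (simp add: at_within_def)
    also have "I - {t} = (I \<inter> {..<t}) \<union> (I \<inter> {t<..})" by auto
    also have "at t within \<dots> = sup ?L ?R"
      by (rule at_within_union)
    finally have "(\<gamma> \<longlongrightarrow> \<gamma> t) (at t within I) \<longleftrightarrow> (\<gamma> \<longlongrightarrow> \<gamma> t) ?L \<and> (\<gamma> \<longlongrightarrow> \<gamma> t) ?R"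
      by (simp add: filterlim_def filtermap_sup)
    also have "(\<gamma> \<longlongrightarrow> \<gamma> t) ?L \<longleftrightarrow> llim I V t = V t"
    proof
      assume "(\<gamma> \<longlongrightarrow> \<gamma> t) ?L"
      then have 0: "((\<lambda>s. dist (\<gamma> s) (\<gamma> t)) \<longlongrightarrow> 0) ?L"
        by (rule tendsto_dist_iff[THEN iffD1])
      have "left_jump I \<gamma> t = 0"
        unfolding left_jump_def by (rule llim_eqI[OF ivl t 0]) simp
      then show "llim I V t = V t" using left_jump_eq[OF t] by simp
    next
      assume "llim I V t = V t"
      then show "(\<gamma> \<longlongrightarrow> \<gamma> t) ?L"
        using tendsto_left_jump[OF t] by (subst tendsto_dist_iff) simp
    qed
    also have "(\<gamma> \<longlongrightarrow> \<gamma> t) ?R \<longleftrightarrow> rlim I V t = V t"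
    proof
      assume "(\<gamma> \<longlongrightarrow> \<gamma> t) ?R"
      then have 0: "((\<lambda>s. dist (\<gamma> t) (\<gamma> s)) \<longlongrightarrow> 0) ?R"
        unfolding dist_swap by (rule tendsto_dist_iff[THEN iffD1])
      have "right_jump I \<gamma> t = 0"
        unfolding right_jump_def by (rule rlim_eqI[OF ivl t 0]) simp
      then show "rlim I V t = V t" using right_jump_eq[OF t] by simp
    next
      assume "rlim I V t = V t"
      then show "(\<gamma> \<longlongrightarrow> \<gamma> t) ?R"
        using tendsto_right_jump[OF t] unfolding dist_swap
        by (subst tendsto_dist_iff) simp
    qed
    finally show ?thesis .
  qed
  then show ?thesis by (simp add: continuous_on_def)
qed

section \<open>The speed measure of compact intervals\<close>

lemma emeasure_speed_measure:
  assumes A: "A \<in> sets (restrict_space borel I)"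
  shows "emeasure \<nu> A = emeasure (stieltjes_measure I (rlim I V)) A +
    (if is_left_end I (Inf I) then ennreal (rlim I V (Inf I) - V (Inf I)) else 0) * indicator A (Inf I)"
proof -
  have ne: "I \<noteq> {}" using c by auto
  let ?S = "stieltjes_measure I (rlim I V)"
  have sets: "sets ?S = sets (restrict_space borel I)"
    by (rule sets_stieltjes_measure[OF ivl ne variation_fun_mono])
  then have space: "space ?S = I"
    using sets_eq_imp_space_eq[OF sets] by (simp add: space_restrict_space)
  define k where "k = (if is_left_end I (Inf I) then ennreal (rlim I V (Inf I) - V (Inf I)) else 0)"
  have "\<nu> = measure_of (space ?S) (sets ?S) (\<lambda>A. emeasure ?S A + k * indicator A (Inf I))"
    unfolding speed_measure_def Let_def sets space k_def
    by (intro arg_cong[where f = "measure_of I (sets (restrict_space borel I))"]) auto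
  then show ?thesis
    using emeasure_measure_of_add_point_mass[of A ?S k "Inf I"] A sets by (simp add: k_def)
qed

lemma emeasure_speed_measure_Icc:
  assumes st: "s \<in> I" "t \<in> I" "s \<le> t"
  shows "emeasure \<nu> {s..t} = ennreal (rlim I V t - llim I V s)"
proof -
  have ne: "I \<noteq> {}" using c by auto
  let ?S = "stieltjes_measure I (rlim I V)"
  note S = sets_stieltjes_measure[OF ivl ne variation_fun_mono]
    emeasure_stieltjes_measure_Ioc[OF ivl ne variation_fun_mono]
    emeasure_stieltjes_measure_left_end[OF ivl ne variation_fun_mono]
  have sub: "{s..t} \<subseteq> I" using Icc_subset_interval[OF ivl st(1,2)] .
  then have Icc: "{s..t} \<in> sets (restrict_space borel I)"
    by (intro interval_in_sets[OF refl ivl]) auto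
  show ?thesis
  proof (cases "is_left_end I s")
    case True
    then have s: "Inf I = s" using left_end_eq_Inf by metis
    have "{s} \<in> sets ?S" "{s<..t} \<in> sets ?S"
      using sub st by (auto intro!: interval_in_sets[OF S(1) ivl] simp: is_interval_1)
    then have "emeasure ?S ({s} \<union> {s<..t}) = emeasure ?S {s} + emeasure ?S {s<..t}"
      by (intro plus_emeasure[symmetric]) auto
    also have "{s} \<union> {s<..t} = {s..t}" using st by auto
    finally have "emeasure ?S {s..t} = ennreal (rlim I V t - rlim I V s)"
      using S(2)[OF st] S(3)[OF True] by simp
    \<comment> \<open>The Stieltjes part misses the jump at the left endpoint and yields V(t+) -
      V(s+); the point mass restores V(s+) - V(s).\<close>
    then have "emeasure \<nu> {s..t} = ennreal (rlim I V t - rlim I V s) + ennreal (rlim I V s - V s)"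
      using emeasure_speed_measure[OF Icc] True s st by simp
    also have "\<dots> = ennreal (rlim I V t - V s)"
      using mono_onD[OF mono_on_rlim[OF ivl variation_fun_mono] st] le_rlim[OF ivl variation_fun_mono st(1)]
      by (simp flip: ennreal_plus)
    also have "V s = llim I V s" using True by (simp add: llim_def)
    finally show ?thesis .
  next
    case False
    have "emeasure ?S {s..t} = ennreal (rlim I V t - llim I V s)"
      by (rule emeasure_Icc_of_Ioc[OF ivl ne variation_fun_mono S(1,2) st False])
    moreover have "Inf I \<notin> {s..t}" if "is_left_end I (Inf I)"
    proof -
      have "Inf I \<noteq> s" using False that by auto
      moreover have "Inf I \<le> s" using that st by (simp add: is_left_end_def)
      ultimately show ?thesis by simp
    qed
    ultimately show ?thesis
      using emeasure_speed_measure[OF Icc] by auto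
  qed
qed

section \<open>Comparison of the speed measure with the variation\<close>

lemma emeasure_speed_measure_eq_variation:
  assumes J: "is_interval J" "J \<subseteq> I"
    and left: "\<And>a. a \<in> J \<Longrightarrow> \<exists>a'\<in>J. a' \<le> a \<and> V a' \<le> llim I V a"
    and right: "\<And>b. b \<in> J \<Longrightarrow> \<exists>b'\<in>J. b \<le> b' \<and> rlim I V b \<le> V b'"
  shows "emeasure \<nu> J = variation \<gamma> J"
proof -
  have "emeasure \<nu> J = (SUP (a, b)\<in>{(a, b). a \<in> J \<and> b \<in> J \<and> a \<le> b}. emeasure \<nu> {a..b})"
    by (rule emeasure_interval_eq_SUP[OF sets_speed_measure ivl J])
  also have "\<dots> = (SUP (a, b)\<in>{(a, b). a \<in> J \<and> b \<in> J \<and> a \<le> b}. variation \<gamma> {a..b})"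
  proof (rule SUP_eq, goal_cases)
    case (1 p)
    then obtain a b where p: "p = (a, b)" "a \<in> J" "b \<in> J" "a \<le> b" by auto
    obtain a' b' where *: "a' \<in> J" "a' \<le> a" "V a' \<le> llim I V a" "b' \<in> J" "b \<le> b'" "rlim I V b \<le> V b'"
      using left[OF p(2)] right[OF p(3)] by blast
    \<comment> \<open>The larger interval absorbs the jumps at the ends: V(b+) - V(a-) is at most
      V(b') - V(a').\<close>
    have "emeasure \<nu> {a..b} \<le> variation \<gamma> {a'..b'}"
      using p * J(2) by (auto simp: emeasure_speed_measure_Icc variation_Icc subset_iff intro!: ennreal_leI)
    then show ?case using p * by (intro bexI[of _ "(a', b')"]) auto
  next
    case (2 p)
    then obtain a b where p: "p = (a, b)" "a \<in> J" "b \<in> J" "a \<le> b" by auto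
    then have I: "a \<in> I" "b \<in> I" using J by auto
    have "variation \<gamma> {a..b} \<le> emeasure \<nu> {a..b}"
      using p I llim_le[OF ivl variation_fun_mono I(1)] le_rlim[OF ivl variation_fun_mono I(2)]
      by (auto simp: emeasure_speed_measure_Icc variation_Icc intro!: ennreal_leI)
    then show ?case using p by (intro bexI[of _ "(a, b)"]) auto
  qed
  also have "\<dots> = variation \<gamma> J"
    by (rule variation_eq_SUP[OF J(1), symmetric])
  finally show ?thesis .
qed

lemma emeasure_speed_measure_open:
  assumes J: "J \<subseteq> I" "connected J" "openin (top_of_set I) J"
  shows "emeasure \<nu> J = variation \<gamma> J"
proof -
  obtain U where U: "open U" "J = I \<inter> U" using J(3) by (auto simp: openin_open)
  have nbhd: "\<exists>e>0. \<forall>y. dist y x < e \<longrightarrow> y \<in> U" if "x \<in> J" for x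
    using U that by (auto simp: open_dist)
  show ?thesis
  proof (rule emeasure_speed_measure_eq_variation)
    show "is_interval J" using J by (simp add: is_interval_connected_1)
    fix a assume a: "a \<in> J"
    then have aI: "a \<in> I" using J by auto
    obtain e where e: "e > 0" "\<And>y. dist y a < e \<Longrightarrow> y \<in> U" using nbhd[OF a] by blast
    show "\<exists>a'\<in>J. a' \<le> a \<and> V a' \<le> llim I V a"
    proof (cases "is_left_end I a")
      case False
      then obtain r where r: "r \<in> I" "r < a" using aI by (auto simp: is_left_end_def not_le)
      \<comment> \<open>Staying right of \<open>r\<close> keeps \<open>a'\<close> in
        \<open>I\<close>, staying within \<open>e / 2\<close> of \<open>a\<close> keeps it in
        \<open>U\<close>. At a left endpoint of \<open>I\<close> the point \<open>a\<close> itself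
        works, as \<open>llim\<close> is V(a) there.\<close>
      define a' where "a' = max r (a - e / 2)"
      have a': "r \<le> a'" "a' < a" "dist a' a < e" using r e by (auto simp: a'_def dist_real_def)
      then have "a' \<in> I" using Icc_subset_interval[OF ivl r(1) aI] by auto
      then show ?thesis
        using a' e(2) U le_llim[OF ivl variation_fun_mono _ aI, of a'] by (intro bexI[of _ a']) auto
    qed (use a in \<open>auto simp: llim_def\<close>)
    show "\<exists>b'\<in>J. a \<le> b' \<and> rlim I V a \<le> V b'"
    proof (cases "is_right_end I a")
      case False
      then obtain r where r: "r \<in> I" "a < r" using aI by (auto simp: is_right_end_def not_le)
      define b' where "b' = min r (a + e / 2)"
      have b': "b' \<le> r" "a < b'" "dist b' a < e" using r e by (auto simp: b'_def dist_real_def)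
      then have "b' \<in> I" using Icc_subset_interval[OF ivl aI r(1)] by auto
      then show ?thesis
        using b' e(2) U rlim_le[OF ivl variation_fun_mono _ aI, of b'] by (intro bexI[of _ b']) auto
    qed (use a in \<open>auto simp: rlim_def\<close>)
  qed (use J in auto)
qed

section \<open>Uniqueness\<close>

text \<open>If \<open>{s..t}\<close> can be extended within \<open>I\<close>, an open interval is
  cut off at a further point of \<open>I\<close>; at an endpoint of \<open>I\<close> the cut may lie
  anywhere outside, since nothing of \<open>I\<close> is there. Either way the piece lies in a
  compact interval with ends in \<open>I\<close>, so its variation is finite.\<close>

lemma open_subinterval_around:
  assumes st: "s \<in> I" "t \<in> I"
  obtains U where "U \<subseteq> I" "connected U" "openin (top_of_set I) U" "{s..t} \<subseteq> U" "variation \<gamma> U < \<infinity>"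
proof -
  obtain l a where l: "l < s" "a \<in> I" "I \<inter> {l<..} \<subseteq> {a..}"
  proof (cases "is_left_end I s")
    case True
    then show thesis using that[of "s - 1" s] st by (auto simp: is_left_end_def)
  next
    case False
    then obtain r where "r \<in> I" "r < s" using st by (auto simp: is_left_end_def not_le)
    then show thesis by (intro that[of r r]) auto
  qed
  obtain r b where r: "t < r" "b \<in> I" "I \<inter> {..<r} \<subseteq> {..b}"
  proof (cases "is_right_end I t")
    case True
    then show thesis using that[of "t + 1" t] st by (auto simp: is_right_end_def)
  next
    case False
    then obtain r where "r \<in> I" "t < r" using st by (auto simp: is_right_end_def not_le)
    then show thesis by (intro that[of r r]) auto
  qed
  show thesis
  proof
    have "is_interval {l<..<r}" by (auto simp: is_interval_1)
    then show "connected (I \<inter> {l<..<r})"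
      unfolding is_interval_connected_1[symmetric] by (rule is_interval_Int[OF ivl])
    show "openin (top_of_set I) (I \<inter> {l<..<r})" by (intro openin_open_Int) auto
    show "{s..t} \<subseteq> I \<inter> {l<..<r}" using Icc_subset_interval[OF ivl st] l r by auto
    have "I \<inter> {l<..<r} \<subseteq> {a..b}" using l r by auto
    from variation_mono[OF this, of \<gamma>] variation_finite[OF l(2) r(2)]
    show "variation \<gamma> (I \<inter> {l<..<r}) < \<infinity>" by (rule le_less_trans)
  qed auto
qed

lemma speed_measure_unique:
  assumes M: "sets M = sets (restrict_space borel I)"
    and eq: "\<And>J. J \<subseteq> I \<Longrightarrow> connected J \<Longrightarrow> openin (top_of_set I) J \<Longrightarrow> emeasure M J = variation \<gamma> J"
  shows "M = \<nu>"
proof -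
  \<comment> \<open>Stated for an arbitrary \<open>N\<close>, so that one formula, whose right-hand
    side involves only the variation, applies to both \<open>M\<close> and \<nu>.\<close>
  have Icc: "emeasure N {s..t} = variation \<gamma> U - variation \<gamma> (U \<inter> {..<s}) - variation \<gamma> (U \<inter> {t<..})"
    if N: "sets N = sets (restrict_space borel I)"
      "\<And>J. J \<subseteq> I \<Longrightarrow> connected J \<Longrightarrow> openin (top_of_set I) J \<Longrightarrow> emeasure N J = variation \<gamma> J"
    and U: "U \<subseteq> I" "connected U" "openin (top_of_set I) U" "{s..t} \<subseteq> U" "variation \<gamma> U < \<infinity>"
    and st: "s \<le> t" for N U s t
  proof -
    define A B where "A = U \<inter> {..<s}" and "B = U \<inter> {t<..}"
    have U': "is_interval U" using U(2) by (simp add: is_interval_connected_1)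
    have ivls: "is_interval A" "is_interval B"
      unfolding A_def B_def by (auto intro!: is_interval_Int[OF U'])
    then have AB: "connected A" "connected B" by (simp_all add: is_interval_connected_1)
    have op: "openin (top_of_set I) A" "openin (top_of_set I) B"
      unfolding A_def B_def using U(3) by (auto intro!: openin_Int_open)
    have sets: "A \<in> sets N" "B \<in> sets N" "U \<in> sets N"
      using ivls U' U(1) by (auto intro!: interval_in_sets[OF N(1) ivl]) (auto simp: A_def B_def)
    \<comment> \<open>Here \<open>s \<le> t\<close> makes the two tails disjoint, so they can be
      subtracted one after the other.\<close>
    have sub: "A \<subseteq> U" "B \<subseteq> U" "B \<subseteq> U - A" using st by (auto simp: A_def B_def)
    have em: "emeasure N A = variation \<gamma> A" "emeasure N B = variation \<gamma> B" "emeasure N U = variation \<gamma> U"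
      using U(1-3) AB op sub by (auto intro!: N(2))
    have fin: "emeasure N A \<noteq> \<infinity>" "emeasure N B \<noteq> \<infinity>"
      using le_less_trans[OF variation_mono[OF sub(1)] U(5)] le_less_trans[OF variation_mono[OF sub(2)] U(5)] em
      by auto
    have "{s..t} = U - A - B" using U(4) by (auto simp: A_def B_def)
    also have "emeasure N \<dots> = emeasure N (U - A) - emeasure N B"
      using sets fin sub by (intro emeasure_Diff) auto
    also have "emeasure N (U - A) = emeasure N U - emeasure N A"
      using sets fin sub by (intro emeasure_Diff) auto
    finally show ?thesis using em by (simp add: A_def B_def)
  qed
  show ?thesis
  proof (rule measure_eqI_Icc[OF ivl _ M sets_speed_measure])
    show "I \<noteq> {}" using c by auto
    fix s t assume st: "s \<in> I" "t \<in> I" "s \<le> t"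
    obtain U where U: "U \<subseteq> I" "connected U" "openin (top_of_set I) U" "{s..t} \<subseteq> U" "variation \<gamma> U < \<infinity>"
      using open_subinterval_around[OF st(1,2)] .
    show "emeasure M {s..t} = emeasure \<nu> {s..t}"
      using Icc[OF M eq U st(3)] Icc[OF sets_speed_measure emeasure_speed_measure_open U st(3)] by simp
    then show "emeasure M {s..t} < \<infinity>"
      using emeasure_speed_measure_Icc[OF st] by simp
  qed
qed

section \<open>Atoms and the continuous case\<close>

lemma emeasure_speed_measure_point:
  "t \<in> I \<Longrightarrow> emeasure \<nu> {t} = ennreal (rlim I V t - llim I V t)"
  using emeasure_speed_measure_Icc[of t t] by simp

text \<open>As V(t-) \<le> V(t) \<le> V(t+), the left and right jumps cannot cancel: the atom
  vanishes only if both do.\<close>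

lemma no_atoms_iff_continuous:
  "(\<forall>t\<in>I. emeasure \<nu> {t} = 0) \<longleftrightarrow> continuous_on I \<gamma>"
proof -
  have "emeasure \<nu> {t} = 0 \<longleftrightarrow> llim I V t = V t \<and> rlim I V t = V t" if "t \<in> I" for t
    using llim_le[OF ivl variation_fun_mono that] le_rlim[OF ivl variation_fun_mono that]
    by (auto simp: emeasure_speed_measure_point[OF that] ennreal_eq_0_iff)
  then show ?thesis by (simp add: continuous_on_iff_no_jumps)
qed

lemma emeasure_speed_measure_continuous:
  assumes cont: "continuous_on I \<gamma>" and J: "J \<subseteq> I" "connected J"
  shows "emeasure \<nu> J = variation \<gamma> J"
proof (rule emeasure_speed_measure_eq_variation)
  show "is_interval J" using J by (simp add: is_interval_connected_1)
  fix a assume a: "a \<in> J"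
  then have "llim I V a = V a" "rlim I V a = V a"
    using cont J continuous_on_iff_no_jumps by auto
  then show "\<exists>a'\<in>J. a' \<le> a \<and> V a' \<le> llim I V a" "\<exists>b'\<in>J. a \<le> b' \<and> rlim I V a \<le> V b'"
    using a by auto
qed (use J in auto)

end

theorem theorem2p7:
  fixes I :: "real set" and \<gamma> :: "real \<Rightarrow> 'a::metric_space" and c :: real
  defines "V \<equiv> variation_fun \<gamma> c"
    and "\<nu> \<equiv> speed_measure I \<gamma> c"
  assumes "connected I"
    and "locally_bounded_variation I \<gamma>"
    and "I \<noteq> {} \<Longrightarrow> c \<in> I"
  shows "(sets \<nu> = sets (restrict_space borel I) \<and>
      (\<forall>J. J \<subseteq> I \<and> connected J \<and> openin (top_of_set I) J \<longrightarrow> emeasure \<nu> J = variation \<gamma> J)) \<and>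
    (\<forall>\<mu>. sets \<mu> = sets (restrict_space borel I) \<and>
      (\<forall>J. J \<subseteq> I \<and> connected J \<and> openin (top_of_set I) J \<longrightarrow> emeasure \<mu> J = variation \<gamma> J)
      \<longrightarrow> \<mu> = \<nu>) \<and>
    (\<forall>t\<in>I. emeasure \<nu> {t} = ennreal (rlim I V t - llim I V t) \<and>
      rlim I V t - llim I V t = left_jump I \<gamma> t + right_jump I \<gamma> t) \<and>
    ((\<forall>t\<in>I. emeasure \<nu> {t} = 0) \<longleftrightarrow> continuous_on I \<gamma>) \<and>
    (continuous_on I \<gamma> \<longrightarrow>
      (\<forall>J. J \<subseteq> I \<and> connected J \<longrightarrow> emeasure \<nu> J = variation \<gamma> J))"
proof (cases "I = {}")
  case True
  \<comment> \<open>There is no base point in an empty \<open>I\<close>, so the locale does not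
    apply; the only measurable set is \<open>{}\<close>, and all measures on it coincide.\<close>
  have uniq: "\<mu> = \<nu>" if "sets \<mu> = sets (restrict_space borel I)" for \<mu> :: "real measure"
  proof (rule measure_eqI)
    show "sets \<mu> = sets \<nu>" using that by (simp add: \<nu>_def sets_speed_measure)
    fix A assume "A \<in> sets \<mu>"
    then have "A = {}" using that True by (auto simp: sets_restrict_space)
    then show "emeasure \<mu> A = emeasure \<nu> A" by simp
  qed
  have "sets \<nu> = sets (restrict_space borel I)" by (simp add: \<nu>_def sets_speed_measure)
  moreover have "emeasure \<nu> J = variation \<gamma> J" if "J \<subseteq> I" for J using that True by simp
  ultimately show ?thesis
    using True by (intro conjI allI impI ballI uniq) auto
next
  case False
  interpret locally_bv_path I \<gamma> c
  proof
    show "is_interval I" using \<open>connected I\<close> by (simp add: is_interval_connected_1)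
  qed (use \<open>locally_bounded_variation I \<gamma>\<close> assms(5) False in blast)+
  show ?thesis
    unfolding V_def \<nu>_def
  proof (intro conjI allI impI ballI)
    show "sets (speed_measure I \<gamma> c) = sets (restrict_space borel I)" by (rule sets_speed_measure)
    show "emeasure (speed_measure I \<gamma> c) J = variation \<gamma> J"
      if "J \<subseteq> I \<and> connected J \<and> openin (top_of_set I) J" for J
      using that by (intro emeasure_speed_measure_open) auto
    show "\<mu> = speed_measure I \<gamma> c"
      if "sets \<mu> = sets (restrict_space borel I) \<and>
        (\<forall>J. J \<subseteq> I \<and> connected J \<and> openin (top_of_set I) J \<longrightarrow> emeasure \<mu> J = variation \<gamma> J)" for \<mu>
      using that by (intro speed_measure_unique) auto
    show "emeasure (speed_measure I \<gamma> c) {t} = ennreal (rlim I (variation_fun \<gamma> c) t - llim I (variation_fun \<gamma> c) t)"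
      if "t \<in> I" for t
      by (rule emeasure_speed_measure_point[OF that])
    show "rlim I (variation_fun \<gamma> c) t - llim I (variation_fun \<gamma> c) t = left_jump I \<gamma> t + right_jump I \<gamma> t"
      if "t \<in> I" for t
      using left_jump_eq[OF that] right_jump_eq[OF that] by simp
    show "(\<forall>t\<in>I. emeasure (speed_measure I \<gamma> c) {t} = 0) \<longleftrightarrow> continuous_on I \<gamma>"
      by (rule no_atoms_iff_continuous)
    show "emeasure (speed_measure I \<gamma> c) J = variation \<gamma> J"
      if "continuous_on I \<gamma>" "J \<subseteq> I \<and> connected J" for J
      using that by (intro emeasure_speed_measure_continuous) auto
  qed
qed

end
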